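(* Every Borel subalgebra $\mathfrak{b}$ of $\mathfrak{g}=\mathfrak{gl}(n+1,\mathbb{C})$ contains strongly regular elements of $\mathfrak{g}$.
   Context: For $x\in\mathfrak{g}$ and $1\le i\le n+1$, $x_i$ denotes the upper left $i\times i$ submatrix of $x$, and $f_{i,j}(x)=\mathrm{Tr}(x_i^j)$ for $1\le j\le i\le n+1$. An element $x\in\mathfrak{g}$ is strongly regular if the differentials $\{df_{i,j}(x):1\le j\le i\le n+1\}$ are linearly independent in $T_x^*\mathfrak{g}$. *)

theory Defs
  imports "HOL-Analysis.Analysis" "Jordan_Normal_Form.Matrix"
begin

definition mtrace :: "complex mat \<Rightarrow> complex" where
  "mtrace A = (\<Sum>i<dim_row A. A $$ (i, i))"

definition lie_bracket :: "complex mat \<Rightarrow> complex mat \<Rightarrow> complex mat" where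
  "lie_bracket a b = a * b - b * a"

definition csubspace_gl :: "nat \<Rightarrow> complex mat set \<Rightarrow> bool" where
  "csubspace_gl N V \<longleftrightarrow> V \<subseteq> carrier_mat N N \<and> 0\<^sub>m N N \<in> V \<and>
     (\<forall>a\<in>V. \<forall>b\<in>V. a + b \<in> V) \<and> (\<forall>c::complex. \<forall>a\<in>V. c \<cdot>\<^sub>m a \<in> V)"

definition cspan_gl :: "nat \<Rightarrow> complex mat set \<Rightarrow> complex mat set" where
  "cspan_gl N S = \<Inter>{V. csubspace_gl N V \<and> S \<subseteq> V}"

definition lie_subalgebra :: "nat \<Rightarrow> complex mat set \<Rightarrow> bool" where
  "lie_subalgebra N B \<longleftrightarrow> csubspace_gl N B \<and> (\<forall>a\<in>B. \<forall>b\<in>B. lie_bracket a b \<in> B)"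

fun derived :: "nat \<Rightarrow> complex mat set \<Rightarrow> nat \<Rightarrow> complex mat set" where
  "derived N B 0 = B"
| "derived N B (Suc k) =
     cspan_gl N {lie_bracket a b | a b. a \<in> derived N B k \<and> b \<in> derived N B k}"

definition solvable_lie :: "nat \<Rightarrow> complex mat set \<Rightarrow> bool" where
  "solvable_lie N B \<longleftrightarrow> (\<exists>k. derived N B k = {0\<^sub>m N N})"

definition borel_subalgebra :: "nat \<Rightarrow> complex mat set \<Rightarrow> bool" where
  "borel_subalgebra N B \<longleftrightarrow> lie_subalgebra N B \<and> solvable_lie N B \<and>
     (\<forall>C. lie_subalgebra N C \<and> solvable_lie N C \<and> B \<subseteq> C \<longrightarrow> C = B)"

definition lead_sub :: "complex mat \<Rightarrow> nat \<Rightarrow> complex mat" where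
  "lead_sub x i = mat i i (\<lambda>(a, b). x $$ (a, b))"

definition f_ij :: "nat \<Rightarrow> nat \<Rightarrow> complex mat \<Rightarrow> complex" where
  "f_ij i j x = mtrace ((lead_sub x i) ^\<^sub>m j)"

text \<open>Differential of f_ij at x, evaluated on the tangent vector y
  (directional derivative; f_ij is polynomial).\<close>
definition df_ij :: "nat \<Rightarrow> nat \<Rightarrow> complex mat \<Rightarrow> complex mat \<Rightarrow> complex" where
  "df_ij i j x y = deriv (\<lambda>t::complex. f_ij i j (x + t \<cdot>\<^sub>m y)) 0"

definition GZ_index :: "nat \<Rightarrow> (nat \<times> nat) set" where
  "GZ_index N = {(i, j). 1 \<le> j \<and> j \<le> i \<and> i \<le> N}"

definition strongly_regular :: "nat \<Rightarrow> complex mat \<Rightarrow> bool" where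
  "strongly_regular N x \<longleftrightarrow> x \<in> carrier_mat N N \<and>
     (\<forall>c :: nat \<times> nat \<Rightarrow> complex.
        (\<forall>y\<in>carrier_mat N N. (\<Sum>p\<in>GZ_index N. c p * df_ij (fst p) (snd p) x y) = 0)
        \<longrightarrow> (\<forall>p\<in>GZ_index N. c p = 0))"

end

theory Submission
  imports Defs "Jordan_Normal_Form.Spectral_Radius"
begin

text \<open>
  By Lie's theorem a Borel subalgebra consists of all \<open>g U g\<^sup>-\<^sup>1\<close> with \<open>U\<close> upper triangular.
  Since \<open>d f_{i,j}(x)(y) = j Tr(x_i^{j-1} y_i)\<close>, strong regularity of \<open>x\<close> means that the powers
  \<open>x_i^k\<close> (\<open>k < i \<le> N\<close>), padded by zeros, are linearly independent. This holds as soon as it holds up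
  to \<open>i = N - 1\<close> and no nonzero polynomial \<open>p\<close> of degree below \<open>N\<close> makes both the last row
  and the last column of \<open>p(x)\<close> vanish: a relation gives \<open>p(x)\<close> supported in the upper left corner.
  Both conditions are Zariski open along lines in the Borel subalgebra, so it suffices to satisfy them
  separately. The first follows by induction, because the corner map sends the Borel subalgebra onto a set
  containing a Borel subalgebra of \<open>gl(N - 1)\<close>; the second is satisfied by a diagonal matrix with distinct
  entries in a basis adapted to the flag, chosen such that for each \<open>i\<close> the \<open>i\<close>-th coordinate of the last
  unit vector or that of the last unit covector is nonzero.
\<close>

unbundle no vec_syntax
unbundle no inner_syntax

text \<open>In general \<open>lead_sub\<close> respects neither products nor brackets on a Borel
  subalgebra, so the induction uses elements preserving the hyperplane of vectors with last
  coordinate zero: on these the corner is a genuine restriction. The position of the flag is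
  recorded by the index \<open>k\<close> of the first basis vector, in flag order, outside that
  hyperplane. A triangular change of basis moves all other basis vectors into it; they then span it
  and carry the Borel subalgebra of the corner. The same \<open>k\<close> forces the alternative
  between unit vector and unit covector: in any adapted basis the vectors before \<open>k\<close>
  have last coordinate zero, so before \<open>k\<close> only the coordinates of the last unit vector
  can help.

  Lie's theorem avoids ideals of codimension one, which would need linear structure. It restricts to
  a minimal invariant subspace, where induction on the length of the chain leaves only scalars.
  Openness along a line uses a Gram determinant because the families usually have more coordinates
  than members and no minor is preferred.\<close>

section \<open>Matrices with independent columns as bases of subspaces\<close>

definition inv_pair :: "nat \<Rightarrow> complex mat \<Rightarrow> complex mat \<Rightarrow> bool" where
  "inv_pair N g h \<longleftrightarrow> g \<in> carrier_mat N N \<and> h \<in> carrier_mat N N \<and> g * h = 1\<^sub>m N \<and> h * g = 1\<^sub>m N"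

text \<open>Linear independence of the columns. A subspace is carried as the column space of such a
  matrix, so that restricting \<open>x\<close> to an invariant subspace means solving
  \<open>x * P = P * X\<close>.\<close>

definition inj_cols :: "complex mat \<Rightarrow> bool" where
  "inj_cols P \<longleftrightarrow> (\<forall>v\<in>carrier_vec (dim_col P). P *\<^sub>v v = 0\<^sub>v (dim_row P) \<longrightarrow> v = 0\<^sub>v (dim_col P))"

lemma inj_colsD:
  assumes "inj_cols P" "P \<in> carrier_mat m k" "v \<in> carrier_vec k" "P *\<^sub>v v = 0\<^sub>v m"
  shows "v = 0\<^sub>v k"
  using assms by (auto simp: inj_cols_def)

lemma inj_colsI:
  assumes "P \<in> carrier_mat m k" "\<And>v. v \<in> carrier_vec k \<Longrightarrow> P *\<^sub>v v = 0\<^sub>v m \<Longrightarrow> v = 0\<^sub>v k"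
  shows "inj_cols P"
  using assms by (auto simp: inj_cols_def)

lemma inv_pair_of_det_ne_0:
  assumes A: "A \<in> carrier_mat n n" and "Determinant.det A \<noteq> 0"
  shows "\<exists>B. inv_pair n A B"
proof -
  have "A \<in> Units (ring_mat TYPE(complex) n ())"
    using det_non_zero_imp_unit[OF assms] .
  then obtain B where "B \<in> carrier_mat n n" "A * B = 1\<^sub>m n" "B * A = 1\<^sub>m n"
    unfolding Units_def ring_mat_def by auto
  with A show ?thesis unfolding inv_pair_def by blast
qed

lemma inv_pair_of_inj_cols:
  assumes P: "P \<in> carrier_mat n n" and inj: "inj_cols P"
  shows "\<exists>Q. inv_pair n P Q"
  using inv_pair_of_det_ne_0[OF P] det_0_iff_vec_prod_zero_field[OF P] inj_colsD[OF inj P] by blast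

text \<open>For \<open>m < k\<close>, padding \<open>P\<close> with zero rows would give an
  injective, hence invertible, square matrix with a zero row \<open>m\<close>.\<close>

lemma inj_cols_dim_le:
  assumes P: "P \<in> carrier_mat m k" and inj: "inj_cols P"
  shows "k \<le> m"
proof (rule ccontr)
  assume "\<not> k \<le> m"
  then have mk: "m < k" by simp
  define A where "A = mat k k (\<lambda>(i,j). if i < m then P $$ (i,j) else 0)"
  have A: "A \<in> carrier_mat k k" by (simp add: A_def)
  have "inj_cols A"
  proof (rule inj_colsI[OF A])
    fix v assume v: "v \<in> carrier_vec k" and Av: "A *\<^sub>v v = 0\<^sub>v k"
    have "P *\<^sub>v v = 0\<^sub>v m"
    proof (rule eq_vecI)
      fix i assume "i < dim_vec (0\<^sub>v m :: complex vec)"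
      then have i: "i < m" by simp
      have "(A *\<^sub>v v) $ i = 0" using Av mk i by simp
      then show "(P *\<^sub>v v) $ i = 0\<^sub>v m $ i"
        using i mk P v by (simp add: A_def scalar_prod_def)
    qed (use P in simp)
    then show "v = 0\<^sub>v k" using inj_colsD[OF inj P v] by simp
  qed
  then obtain B where B: "B \<in> carrier_mat k k" "A * B = 1\<^sub>m k"
    using inv_pair_of_inj_cols[OF A] unfolding inv_pair_def by blast
  have "(A * B) $$ (m,m) = 0"
    using mk A B(1) by (simp add: A_def scalar_prod_def)
  then show False using B mk by simp
qed

lemma inj_cols_mult:
  assumes P: "P \<in> carrier_mat m k" "inj_cols P" and Q: "Q \<in> carrier_mat k l" "inj_cols Q"
  shows "inj_cols (P * Q)"
proof (rule inj_colsI)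
  show "P * Q \<in> carrier_mat m l" using P Q by simp
  fix v assume v: "v \<in> carrier_vec l" and 0: "P * Q *\<^sub>v v = 0\<^sub>v m"
  then have "P *\<^sub>v (Q *\<^sub>v v) = 0\<^sub>v m" using P Q v by (simp add: assoc_mult_mat_vec[of _ m k])
  then have "Q *\<^sub>v v = 0\<^sub>v k" using inj_colsD[OF P(2,1)] Q v by simp
  then show "v = 0\<^sub>v l" using inj_colsD[OF Q(2,1) v] by simp
qed

lemma mult_col_eq: "A \<in> carrier_mat m k \<Longrightarrow> B \<in> carrier_mat k l \<Longrightarrow> j < l \<Longrightarrow> col (A * B) j = A *\<^sub>v col B j"
  by (auto simp: col_mult2)

lemma mult_unit_vec:
  fixes A :: "'a :: semiring_1 mat"
  shows "A \<in> carrier_mat m k \<Longrightarrow> j < k \<Longrightarrow> A *\<^sub>v unit_vec k j = col A j"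
  by (intro eq_vecI) (auto simp: scalar_prod_right_unit)

lemma zero_mult_vec:
  fixes v :: "'a :: semiring_1 vec"
  shows "v \<in> carrier_vec k \<Longrightarrow> 0\<^sub>m m k *\<^sub>v v = 0\<^sub>v m"
  by (intro eq_vecI) auto

lemma inj_cols_cancel_vec:
  assumes P: "P \<in> carrier_mat m k" "inj_cols P" and v: "v \<in> carrier_vec k" "w \<in> carrier_vec k"
    and eq: "P *\<^sub>v v = P *\<^sub>v w"
  shows "v = w"
proof -
  have "P *\<^sub>v (v - w) = 0\<^sub>v m"
    using mult_minus_distrib_mat_vec[OF P(1) v] eq P v by auto
  then have "v - w = 0\<^sub>v k" using inj_colsD[OF P(2,1)] v by simp
  then have "(v - w) $ i = 0" if "i < k" for i using that by simp
  then show ?thesis using v by (intro eq_vecI) auto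
qed

lemma inj_cols_cancel:
  assumes P: "P \<in> carrier_mat m k" "inj_cols P" and A: "A \<in> carrier_mat k l" "B \<in> carrier_mat k l"
    and eq: "P * A = P * B"
  shows "A = B"
proof (rule mat_col_eqI)
  fix j assume "j < dim_col B"
  then have j: "j < l" using A by simp
  have "P *\<^sub>v col A j = P *\<^sub>v col B j" using mult_col_eq[OF P(1)] A j eq by metis
  then show "col A j = col B j" using inj_cols_cancel_vec[OF P] A j by (metis col_carrier_vec)
qed (use A in auto)

text \<open>Each column is solved for separately. The predicate \<open>R\<close> transports a
  property of the chosen coordinate vectors to the columns of \<open>X\<close>, later the value of a
  diagonal entry; \<open>True\<close> stands for no demand.\<close>

lemma factor_through_cols:
  assumes P: "P \<in> carrier_mat m k" and Y: "Y \<in> carrier_mat m l"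
    and ex: "\<And>j. j < l \<Longrightarrow> \<exists>v\<in>carrier_vec k. col Y j = P *\<^sub>v v \<and> R j v"
  shows "\<exists>X\<in>carrier_mat k l. Y = P * X \<and> (\<forall>j<l. R j (col X j))"
proof -
  obtain f where f: "\<And>j. j < l \<Longrightarrow> f j \<in> carrier_vec k \<and> col Y j = P *\<^sub>v f j \<and> R j (f j)"
    using ex by metis
  define X where "X = mat k l (\<lambda>(i,j). f j $ i)"
  have X: "X \<in> carrier_mat k l" by (simp add: X_def)
  have cX: "col X j = f j" if "j < l" for j using f[OF that] that by (intro eq_vecI) (auto simp: X_def)
  have "Y = P * X"
  proof (rule mat_col_eqI)
    fix j assume "j < dim_col (P * X)"
    then have j: "j < l" using X by simp
    show "col Y j = col (P * X) j" using mult_col_eq[OF P X j] cX[OF j] f[OF j] by simp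
  qed (use P X Y in auto)
  then show ?thesis using X cX f by auto
qed

lemma mult_snoc_col:
  fixes P :: "complex mat"
  assumes P: "P \<in> carrier_mat m k" and s: "s \<in> carrier_vec m" and v: "v \<in> carrier_vec (Suc k)"
  shows "mat m (Suc k) (\<lambda>(i,j). if j < k then P $$ (i,j) else s $ i) *\<^sub>v v
    = P *\<^sub>v vec k (\<lambda>i. v $ i) + v $ k \<cdot>\<^sub>v s"
  using assms by (intro eq_vecI) (auto simp: scalar_prod_def mult.commute)

text \<open>A nonzero last coefficient in a relation would express \<open>s\<close> by the columns
  of \<open>P\<close>; if it is zero, the relation concerns \<open>P\<close> alone.\<close>

lemma inj_cols_snoc:
  assumes P: "P \<in> carrier_mat m k" "inj_cols P" and s: "s \<in> carrier_vec m"
    and notin: "\<And>v. v \<in> carrier_vec k \<Longrightarrow> s \<noteq> P *\<^sub>v v"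
  shows "inj_cols (mat m (Suc k) (\<lambda>(i,j). if j < k then P $$ (i,j) else s $ i))"
proof (rule inj_colsI)
  fix v assume v: "v \<in> carrier_vec (Suc k)"
    and 0: "mat m (Suc k) (\<lambda>(i,j). if j < k then P $$ (i,j) else s $ i) *\<^sub>v v = 0\<^sub>v m"
  define v' where "v' = vec k (\<lambda>i. v $ i)"
  have v': "v' \<in> carrier_vec k" by (simp add: v'_def)
  have eq: "P *\<^sub>v v' + v $ k \<cdot>\<^sub>v s = 0\<^sub>v m" using 0 mult_snoc_col[OF P(1) s v] v'_def by simp
  have vk: "v $ k = 0"
  proof (rule ccontr)
    assume c: "v $ k \<noteq> 0"
    have "s = P *\<^sub>v ((- 1 / v $ k) \<cdot>\<^sub>v v')"
    proof (rule eq_vecI)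
      fix i assume "i < dim_vec (P *\<^sub>v ((- 1 / v $ k) \<cdot>\<^sub>v v'))"
      then have i: "i < m" using P by simp
      have "(P *\<^sub>v v' + v $ k \<cdot>\<^sub>v s) $ i = 0" using eq i by simp
      then have "(P *\<^sub>v v') $ i + v $ k * s $ i = 0" using i s P by simp
      then have "s $ i = (- 1 / v $ k) * (P *\<^sub>v v') $ i" using c by (simp add: field_simps add_eq_0_iff2)
      then show "s $ i = (P *\<^sub>v ((- 1 / v $ k) \<cdot>\<^sub>v v')) $ i" 
        using mult_mat_vec[OF P(1) v'] i P by simp
    qed (use P s in simp)
    then show False using notin v' by (metis smult_carrier_vec)
  qed
  have "P *\<^sub>v v' = 0\<^sub>v m" using eq vk s P v' by (intro eq_vecI) (auto simp: vec_eq_iff)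
  then have z: "v' = 0\<^sub>v k" using inj_colsD[OF P(2,1) v'] by simp
  show "v = 0\<^sub>v (Suc k)"
  proof (rule eq_vecI)
    fix i assume "i < dim_vec (0\<^sub>v (Suc k) :: complex vec)"
    then have "i < k \<or> i = k" by auto
    moreover have "v $ i = 0" if "i < k" using arg_cong[OF z, of "\<lambda>u. u $ i"] that by (simp add: v'_def)
    ultimately show "v $ i = 0\<^sub>v (Suc k) $ i" using vk by auto
  qed (use v in simp)
qed simp

definition subspace_vec :: "nat \<Rightarrow> complex vec set \<Rightarrow> bool" where
  "subspace_vec m S \<longleftrightarrow> S \<subseteq> carrier_vec m \<and> 0\<^sub>v m \<in> S \<and> (\<forall>u\<in>S. \<forall>v\<in>S. u + v \<in> S) \<and> (\<forall>c. \<forall>u\<in>S. c \<cdot>\<^sub>v u \<in> S)"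

lemma inj_cols_0: "P \<in> carrier_mat m 0 \<Longrightarrow> inj_cols P"
  by (rule inj_colsI) auto

text \<open>A matrix with the largest possible number of independent columns inside \<open>S\<close>
  spans \<open>S\<close>, since a vector of \<open>S\<close> outside its column space could be
  appended. The number is bounded by \<open>inj_cols_dim_le\<close>.\<close>

lemma subspace_vec_basis:
  assumes S: "subspace_vec m S"
  shows "\<exists>k. \<exists>P\<in>carrier_mat m k. inj_cols P \<and> S = {P *\<^sub>v v | v. v \<in> carrier_vec k}"
proof -
  define Q where "Q k \<longleftrightarrow> (\<exists>P\<in>carrier_mat m k. inj_cols P \<and> (\<forall>v\<in>carrier_vec k. P *\<^sub>v v \<in> S))" for k
  have "Q 0" unfolding Q_def
  proof (intro bexI conjI ballI)
    fix v :: "complex vec" assume "v \<in> carrier_vec 0"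
    then have "0\<^sub>m m 0 *\<^sub>v v = 0\<^sub>v m" by (intro eq_vecI) (auto simp: scalar_prod_def)
    then show "0\<^sub>m m 0 *\<^sub>v v \<in> S" using S by (simp add: subspace_vec_def)
  qed (auto intro: inj_cols_0[of _ m])
  moreover have "\<And>k. Q k \<Longrightarrow> k \<le> m" unfolding Q_def using inj_cols_dim_le by blast
  ultimately obtain k where k: "Q k" and max: "\<And>j. Q j \<Longrightarrow> j \<le> k"
    using GreatestI_nat[of Q 0 m] Greatest_le_nat[of Q _ m] by blast
  then obtain P where P: "P \<in> carrier_mat m k" "inj_cols P" and PS: "\<And>v. v \<in> carrier_vec k \<Longrightarrow> P *\<^sub>v v \<in> S"
    unfolding Q_def by blast
  have "\<exists>v\<in>carrier_vec k. s = P *\<^sub>v v" if s: "s \<in> S" for s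
  proof (rule ccontr)
    assume "\<not> ?thesis"
    then have n: "\<And>v. v \<in> carrier_vec k \<Longrightarrow> s \<noteq> P *\<^sub>v v" by blast
    have sm: "s \<in> carrier_vec m" using S s by (auto simp: subspace_vec_def)
    have "Q (Suc k)" unfolding Q_def
    proof (intro bexI conjI ballI)
      show "inj_cols (mat m (Suc k) (\<lambda>(i,j). if j < k then P $$ (i,j) else s $ i))"
        by (rule inj_cols_snoc[OF P sm n])
      fix v :: "complex vec" assume v: "v \<in> carrier_vec (Suc k)"
      have "P *\<^sub>v vec k (($) v) \<in> S" using PS by simp
      then show "mat m (Suc k) (\<lambda>(i,j). if j < k then P $$ (i,j) else s $ i) *\<^sub>v v \<in> S"
        unfolding mult_snoc_col[OF P(1) sm v] using S s unfolding subspace_vec_def by simp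
    qed simp
    then show False using max by fastforce
  qed
  then have "S = {P *\<^sub>v v | v. v \<in> carrier_vec k}" using PS by blast
  then show ?thesis using P by blast
qed

section \<open>Traces, brackets and restriction to an invariant subspace\<close>

lemma mtrace_comm:
  assumes "A \<in> carrier_mat n m" "B \<in> carrier_mat m n"
  shows "mtrace (A * B) = mtrace (B * A)"
proof -
  have "mtrace (A * B) = (\<Sum>i<n. \<Sum>j<m. A $$ (i,j) * B $$ (j,i))"
    using assms by (simp add: mtrace_def scalar_prod_def atLeast0LessThan)
  also have "\<dots> = (\<Sum>j<m. \<Sum>i<n. B $$ (j,i) * A $$ (i,j))"
    by (subst sum.swap) (simp add: mult.commute)
  also have "\<dots> = mtrace (B * A)"
    using assms by (simp add: mtrace_def scalar_prod_def atLeast0LessThan)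
  finally show ?thesis .
qed

lemma mtrace_minus:
  assumes "A \<in> carrier_mat n n" "B \<in> carrier_mat n n"
  shows "mtrace (A - B) = mtrace A - mtrace B"
  using assms by (simp add: mtrace_def sum_subtractf)

lemma mtrace_lie_bracket:
  assumes "A \<in> carrier_mat n n" "B \<in> carrier_mat n n"
  shows "mtrace (lie_bracket A B) = 0"
  using assms by (simp add: lie_bracket_def mtrace_minus[of _ n] mtrace_comm[of A n n])

lemma lie_bracket_carrier[simp]:
  "a \<in> carrier_mat n n \<Longrightarrow> b \<in> carrier_mat n n \<Longrightarrow> lie_bracket a b \<in> carrier_mat n n"
  unfolding lie_bracket_def by auto

text \<open>When the columns of \<open>P\<close> are independent, \<open>x * P = P * X\<close> says
  that \<open>X\<close> is the action of \<open>x\<close> on their span, written in that basis; such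
  actions compose.\<close>

lemma mult_intertwine:
  assumes P: "P \<in> carrier_mat m r" and x: "x \<in> carrier_mat m m" and y: "y \<in> carrier_mat m m" 
    and X: "X \<in> carrier_mat r r" and Y: "Y \<in> carrier_mat r r" and eq: "x * P = P * X" "y * P = P * Y"
  shows "x * y * P = P * (X * Y)"
proof -
  have "x * y * P = x * (y * P)" by (rule assoc_mult_mat[OF x y P])
  also have "\<dots> = x * P * Y" unfolding eq(2) by (rule assoc_mult_mat[OF x P Y, symmetric])
  also have "\<dots> = P * (X * Y)" unfolding eq(1) by (rule assoc_mult_mat[OF P X Y])
  finally show ?thesis .
qed

lemma lie_bracket_intertwine:
  assumes "P \<in> carrier_mat m r" "x \<in> carrier_mat m m" "y \<in> carrier_mat m m" 
    "X \<in> carrier_mat r r" "Y \<in> carrier_mat r r" "x * P = P * X" "y * P = P * Y"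
  shows "lie_bracket x y * P = P * lie_bracket X Y"
proof -
  have "lie_bracket x y * P = x * y * P - y * x * P"
    unfolding lie_bracket_def using assms by (simp add: minus_mult_distrib_mat[of _ m m])
  also have "x * y * P = P * (X * Y)" using mult_intertwine assms by blast
  also have "y * x * P = P * (Y * X)" using mult_intertwine assms by blast
  also have "P * (X * Y) - P * (Y * X) = P * lie_bracket X Y"
    unfolding lie_bracket_def using assms by (subst mult_minus_distrib_mat[of _ m r _ r]) auto
  finally show ?thesis .
qed

section \<open>Lie's theorem\<close>

text \<open>A weakening of solvability that ignores linearity: only a chain of subsets, each containing the brackets of the previous one, is kept. It is all that Lie's theorem needs, and it passes to images under maps preserving brackets.\<close>

primrec solvable_chain :: "nat \<Rightarrow> nat \<Rightarrow> complex mat set \<Rightarrow> bool" where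
  "solvable_chain N 0 B \<longleftrightarrow> B \<subseteq> {0\<^sub>m N N}"
| "solvable_chain N (Suc k) B \<longleftrightarrow> B \<subseteq> carrier_mat N N \<and>
     (\<exists>D. solvable_chain N k D \<and> D \<subseteq> B \<and> (\<forall>a\<in>B. \<forall>b\<in>B. lie_bracket a b \<in> D))"

lemma solvable_chain_carrier: "solvable_chain N k B \<Longrightarrow> B \<subseteq> carrier_mat N N"
  by (cases k) auto

lemma solvable_chain_empty: "solvable_chain N k {}"
  by (induction k) (auto intro!: exI[of _ "{}"])

text \<open>\<open>h\<close> may be any function, so a restriction chosen matrix by matrix is
  allowed. The image of zero enters at the bottom of the chain, where only the zero matrix may be
  left.\<close>

lemma solvable_chain_image:
  assumes "solvable_chain N k B"
    and "\<And>a. a \<in> B \<Longrightarrow> h a \<in> carrier_mat M M"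
    and "\<And>a b. a \<in> B \<Longrightarrow> b \<in> B \<Longrightarrow> h (lie_bracket a b) = lie_bracket (h a) (h b)"
    and "h (0\<^sub>m N N) = 0\<^sub>m M M"
  shows "solvable_chain M k (h ` B)"
  using assms
proof (induction k arbitrary: B)
  case 0
  then show ?case by auto
next
  case (Suc k)
  then obtain D where D: "solvable_chain N k D" "D \<subseteq> B" "\<And>a b. a \<in> B \<Longrightarrow> b \<in> B \<Longrightarrow> lie_bracket a b \<in> D" by auto
  have "solvable_chain M k (h ` D)"
    using Suc.IH[OF D(1)] Suc.prems(2-4) D(2) by (meson subsetD)
  moreover have "\<forall>a\<in>h ` B. \<forall>b\<in>h ` B. lie_bracket a b \<in> h ` D"
    using D(3) Suc.prems(3) by (auto simp flip: Suc.prems(3))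
  ultimately show ?case using D(2) Suc.prems(2) unfolding solvable_chain.simps
    by (intro conjI exI[of _ "h ` D"]) auto
qed

section \<open>Krylov spaces: spans of \<open>u i\<close> with \<open>i < k\<close>, where
  \<open>u\<close> is the orbit of \<open>u 0\<close> under \<open>z\<close>\<close>

primrec krylov :: "nat \<Rightarrow> (nat \<Rightarrow> complex vec) \<Rightarrow> nat \<Rightarrow> complex vec set" where
  "krylov m u 0 = {0\<^sub>v m}"
| "krylov m u (Suc k) = {s + c \<cdot>\<^sub>v u k | s c. s \<in> krylov m u k}"

context
  fixes m :: nat and z :: "complex mat" and u :: "nat \<Rightarrow> complex vec"
  assumes z: "z \<in> carrier_mat m m" and u0: "u 0 \<in> carrier_vec m" and u_Suc: "\<And>k. u (Suc k) = z *\<^sub>v u k"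
begin

lemma u_carrier[simp]: "u k \<in> carrier_vec m"
  using z u0 by (induction k) (auto simp: u_Suc)

lemma dim_u[simp]: "dim_vec (u k) = m"
  using u_carrier[of k] by simp

lemma krylov_carrier: "s \<in> krylov m u k \<Longrightarrow> s \<in> carrier_vec m"
  by (induction k arbitrary: s) auto

lemma krylov_mono_Suc: "s \<in> krylov m u k \<Longrightarrow> s \<in> krylov m u (Suc k)"
proof -
  assume s: "s \<in> krylov m u k"
  have "s = s + 0 \<cdot>\<^sub>v u k" using krylov_carrier[OF s] u_carrier[of k] by (intro eq_vecI) auto
  then show ?thesis using s by auto
qed

lemma krylov_mono: "j \<le> k \<Longrightarrow> s \<in> krylov m u j \<Longrightarrow> s \<in> krylov m u k"
proof (induction rule: dec_induct)
  case (step k)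
  then show ?case using krylov_mono_Suc by blast
qed

lemma krylov_add: "s \<in> krylov m u k \<Longrightarrow> t \<in> krylov m u k \<Longrightarrow> s + t \<in> krylov m u k"
proof (induction k arbitrary: s t)
  case (Suc k)
  then obtain s' c t' d where st: "s' \<in> krylov m u k" "t' \<in> krylov m u k"
    "s = s' + c \<cdot>\<^sub>v u k" "t = t' + d \<cdot>\<^sub>v u k" by auto
  have "s + t = (s' + t') + (c + d) \<cdot>\<^sub>v u k"
    unfolding st(3,4) using krylov_carrier[OF st(1)] krylov_carrier[OF st(2)] u_carrier[of k]
    by (intro eq_vecI) (auto simp: algebra_simps)
  then show ?case using Suc.IH[OF st(1,2)] by auto
qed auto

lemma krylov_smult: "s \<in> krylov m u k \<Longrightarrow> c \<cdot>\<^sub>v s \<in> krylov m u k"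
proof (induction k arbitrary: s)
  case (Suc k)
  then obtain s' d where st: "s' \<in> krylov m u k" "s = s' + d \<cdot>\<^sub>v u k" by auto
  have "c \<cdot>\<^sub>v s = c \<cdot>\<^sub>v s' + (c * d) \<cdot>\<^sub>v u k"
    unfolding st(2) using krylov_carrier[OF st(1)]
    by (intro eq_vecI) (auto simp: algebra_simps)
  then show ?case using Suc.IH[OF st(1)] by auto
qed auto

lemma u_in_krylov: "u k \<in> krylov m u (Suc k)"
proof -
  have "0\<^sub>v m \<in> krylov m u k" using krylov_mono[of 0 k "0\<^sub>v m"] by simp
  moreover have "u k = 0\<^sub>v m + 1 \<cdot>\<^sub>v u k"
    using u_carrier[of k] by simp
  ultimately show ?thesis unfolding krylov.simps by blast
qed

lemma krylov_step: "s \<in> krylov m u k \<Longrightarrow> z *\<^sub>v s \<in> krylov m u (Suc k)"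
proof (induction k arbitrary: s)
  case 0
  have "z *\<^sub>v 0\<^sub>v m = 0\<^sub>v m" using z by (intro eq_vecI) auto
  then show ?case using 0 krylov_mono_Suc[of "0\<^sub>v m" 0] by simp
next
  case (Suc k)
  then obtain s' d where st: "s' \<in> krylov m u k" "s = s' + d \<cdot>\<^sub>v u k" by auto
  have "z *\<^sub>v s = z *\<^sub>v s' + d \<cdot>\<^sub>v u (Suc k)"
    unfolding st(2) u_Suc 
    using krylov_carrier[OF st(1)] u_carrier[of k] z
    by (simp add: mult_add_distrib_mat_vec[of _ m m] mult_mat_vec[of _ m m])
  then show ?case using Suc.IH[OF st(1)] krylov.simps(2)[of m u "Suc k"] by auto
qed

definition krylov_mat :: "nat \<Rightarrow> complex mat" where
  "krylov_mat k = mat m k (\<lambda>(i,j). u j $ i)"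

lemma krylov_mat_carrier[simp]: "krylov_mat k \<in> carrier_mat m k"
  by (simp add: krylov_mat_def)

lemma krylov_mat_Suc: "krylov_mat (Suc k)
    = mat m (Suc k) (\<lambda>(i,j). if j < k then krylov_mat k $$ (i,j) else u k $ i)"
  unfolding krylov_mat_def by (intro eq_matI) (auto simp: less_Suc_eq)

lemma krylov_mat_mult_in: "v \<in> carrier_vec k \<Longrightarrow> krylov_mat k *\<^sub>v v \<in> krylov m u k"
proof (induction k arbitrary: v)
  case 0
  then show ?case by (auto intro!: eq_vecI simp: krylov_mat_def scalar_prod_def)
next
  case (Suc k)
  show ?case unfolding krylov_mat_Suc mult_snoc_col[OF krylov_mat_carrier u_carrier Suc.prems]
    using Suc.IH[of "vec k (\<lambda>i. v $ i)"] by auto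
qed

lemma inj_cols_krylov_mat:
  "(\<And>j. j < k \<Longrightarrow> u j \<notin> krylov m u j) \<Longrightarrow> inj_cols (krylov_mat k)"
proof (induction k)
  case 0
  then show ?case using inj_cols_0[of "krylov_mat 0" m] by simp
next
  case (Suc k)
  then show ?case unfolding krylov_mat_Suc
    using krylov_mat_mult_in by (intro inj_cols_snoc[OF krylov_mat_carrier _ u_carrier]) force+
qed

text \<open>The vanishing of the coordinates from \<open>j\<close> on encodes triangularity: a
  remainder in stage \<open>j\<close> does not affect the diagonal entry at
  \<open>j\<close>.\<close>

lemma krylov_coords:
  assumes "s \<in> krylov m u j" "j \<le> k"
  shows "\<exists>t\<in>carrier_vec k. s = krylov_mat k *\<^sub>v t \<and> (\<forall>i. j \<le> i \<longrightarrow> i < k \<longrightarrow> t $ i = 0)"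
  using assms
proof (induction j arbitrary: s)
  case 0
  then show ?case using krylov_mat_carrier[of k]
    by (intro bexI[of _ "0\<^sub>v k"]) (auto intro!: eq_vecI simp del: krylov_mat_carrier)
next
  case (Suc j)
  then obtain s' c where st: "s' \<in> krylov m u j" "s = s' + c \<cdot>\<^sub>v u j" by auto
  then obtain t where t: "t \<in> carrier_vec k" "s' = krylov_mat k *\<^sub>v t" "\<And>i. j \<le> i \<Longrightarrow> i < k \<Longrightarrow> t $ i = 0"
    using Suc.IH Suc.prems by (metis Suc_leD)
  have j: "j < k" using Suc.prems by simp
  have e: "u j = krylov_mat k *\<^sub>v unit_vec k j"
    using j u_carrier[of j] by (intro eq_vecI) (auto simp: krylov_mat_def scalar_prod_right_unit)
  have "s = krylov_mat k *\<^sub>v (t + c \<cdot>\<^sub>v unit_vec k j)"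
    unfolding st(2) e t(2) using t(1) krylov_mat_carrier[of k]
    by (simp add: mult_add_distrib_mat_vec[of _ m k] mult_mat_vec[of _ m k])
  then show ?case using t j
    by (intro bexI[of _ "t + c \<cdot>\<^sub>v unit_vec k j"]) auto
qed

text \<open>On the span of \<open>u 0, z u 0, z\<^sup>2 u 0, \<dots>\<close> every \<open>d \<in> D\<close> is triangular with diagonal \<open>\<mu> d\<close>, while \<open>lie_bracket d z\<close> is a commutator and has trace zero there.\<close>

lemma weight_lie_bracket_eq_0:
  assumes D: "D \<subseteq> carrier_mat m m" and w0: "u 0 \<noteq> 0\<^sub>v m"
    and wt: "\<And>d. d \<in> D \<Longrightarrow> d *\<^sub>v u 0 = \<mu> d \<cdot>\<^sub>v u 0"
    and br: "\<And>d. d \<in> D \<Longrightarrow> lie_bracket d z \<in> D" and d: "d \<in> D"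
  shows "\<mu> (lie_bracket d z) = 0"
proof -
  \<comment> \<open>The induction runs over all of \<open>D\<close> at once: moving \<open>d\<close>
    past \<open>z\<close> produces \<open>lie_bracket d z\<close>, another element of
    \<open>D\<close>, to which the hypothesis for \<open>j\<close> applies.\<close>
  have tri: "\<exists>s\<in>krylov m u j. d *\<^sub>v u j = \<mu> d \<cdot>\<^sub>v u j + s" if "d \<in> D" for d j
    using that
  proof (induction j arbitrary: d)
    case 0
    then show ?case using wt[OF 0] by auto
  next
    case (Suc j)
    let ?v = "u j"
    have v: "?v \<in> carrier_vec m" by simp
    have dc: "d \<in> carrier_mat m m" using Suc.prems D by auto
    have dz: "lie_bracket d z \<in> D" using br[OF Suc.prems] .
    obtain s where s: "s \<in> krylov m u j" "d *\<^sub>v ?v = \<mu> d \<cdot>\<^sub>v ?v + s" using Suc.IH[OF Suc.prems] by blast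
    obtain s' where s': "s' \<in> krylov m u j" "lie_bracket d z *\<^sub>v ?v = \<mu> (lie_bracket d z) \<cdot>\<^sub>v ?v + s'"
      using Suc.IH[OF dz] by blast
    have "d *\<^sub>v (z *\<^sub>v ?v) = z *\<^sub>v (d *\<^sub>v ?v) + lie_bracket d z *\<^sub>v ?v"
      unfolding lie_bracket_def using dc z v
      by (simp add: minus_mult_distrib_mat_vec[of _ m m] assoc_mult_mat_vec[of _ m m])
         (intro eq_vecI; simp)
    also have "\<dots> = \<mu> d \<cdot>\<^sub>v (z *\<^sub>v ?v) + (z *\<^sub>v s + (\<mu> (lie_bracket d z) \<cdot>\<^sub>v ?v + s'))"
      unfolding s s' using z v krylov_carrier[OF s(1)] krylov_carrier[OF s'(1)]
      by (simp add: mult_add_distrib_mat_vec[of _ m m] mult_mat_vec[of _ m m] assoc_add_vec[of _ m])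
    finally have "d *\<^sub>v u (Suc j) = \<mu> d \<cdot>\<^sub>v u (Suc j) + (z *\<^sub>v s + (\<mu> (lie_bracket d z) \<cdot>\<^sub>v ?v + s'))"
      unfolding u_Suc .
    moreover have "z *\<^sub>v s + (\<mu> (lie_bracket d z) \<cdot>\<^sub>v ?v + s') \<in> krylov m u (Suc j)"
      using krylov_step[OF s(1)] krylov_smult[OF u_in_krylov] krylov_mono_Suc[OF s'(1)] krylov_add by blast
    ultimately show ?case by blast
  qed
  have "\<exists>k. u k \<in> krylov m u k"
  proof (rule ccontr)
    assume "\<not> ?thesis"
    then have "inj_cols (krylov_mat (Suc m))" using inj_cols_krylov_mat by blast
    then show False using inj_cols_dim_le[OF krylov_mat_carrier] by fastforce
  qed
  \<comment> \<open>At the first dependent index \<open>k\<close>, the vectors before it form a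
    basis of a subspace stable under \<open>z\<close>.\<close>
  then obtain k where k: "u k \<in> krylov m u k" "\<And>j. j < k \<Longrightarrow> u j \<notin> krylov m u j"
    using exists_least_iff[of "\<lambda>k. u k \<in> krylov m u k"] by blast
  define P where "P = krylov_mat k"
  have P: "P \<in> carrier_mat m k" "inj_cols P"
    unfolding P_def using inj_cols_krylov_mat k(2) by auto
  have k0: "k > 0" using k(1) w0 by (cases k) auto
  have colP: "col P j = u j" if "j < k" for j
    using that u_carrier[of j] by (intro eq_vecI) (auto simp: P_def krylov_mat_def)
  have T: "\<exists>T\<in>carrier_mat k k. d * P = P * T \<and> (\<forall>j<k. col T j $ j = \<mu> d)" if d: "d \<in> D" for d
  proof (rule factor_through_cols[OF P(1)])
    have dc: "d \<in> carrier_mat m m" using d D by auto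
    then show "d * P \<in> carrier_mat m k" using P by simp
    fix j assume j: "j < k"
    obtain s where s: "s \<in> krylov m u j" "d *\<^sub>v u j = \<mu> d \<cdot>\<^sub>v u j + s" using tri[OF d] by blast
    obtain t where t: "t \<in> carrier_vec k" "s = P *\<^sub>v t" "t $ j = 0"
      using krylov_coords[OF s(1), of k] j P_def by auto
    have e: "u j = P *\<^sub>v unit_vec k j"
      using j u_carrier[of j] by (intro eq_vecI) (auto simp: P_def krylov_mat_def scalar_prod_right_unit)
    have "col (d * P) j = d *\<^sub>v u j" using mult_col_eq[OF dc P(1) j] colP[OF j] by simp
    also have "\<dots> = \<mu> d \<cdot>\<^sub>v (P *\<^sub>v unit_vec k j) + P *\<^sub>v t"
      using s(2) t(2) e by simp
    also have "\<dots> = P *\<^sub>v (\<mu> d \<cdot>\<^sub>v unit_vec k j + t)"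
      using P t(1)
      by (simp add: mult_add_distrib_mat_vec[of _ m k] mult_mat_vec[of _ m k])
    finally show "\<exists>v\<in>carrier_vec k. col (d * P) j = P *\<^sub>v v \<and> v $ j = \<mu> d"
      using t j by (intro bexI[of _ "\<mu> d \<cdot>\<^sub>v unit_vec k j + t"]) auto
  qed
  have "\<exists>Z\<in>carrier_mat k k. z * P = P * Z \<and> (\<forall>j<k. True)"
  proof (rule factor_through_cols[OF P(1)])
    show "z * P \<in> carrier_mat m k" using P z by simp
    fix j assume j: "j < k"
    have "col (z * P) j = u (Suc j)" using mult_col_eq[OF z P(1) j] colP[OF j] u_Suc by simp
    also have "\<dots> \<in> krylov m u k"
    \<comment> \<open>The image of the last column is \<open>u k\<close>, which lies in the span by
      the choice of \<open>k\<close>.\<close>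
    proof (cases "Suc j = k")
      case False
      then show ?thesis using krylov_mono[OF _ u_in_krylov, of "Suc j" k] j by simp
    qed (use k in simp)
    finally show "\<exists>v\<in>carrier_vec k. col (z * P) j = P *\<^sub>v v \<and> True"
      using krylov_coords[of _ k k] P_def by blast
  qed
  then obtain Z where Z: "Z \<in> carrier_mat k k" "z * P = P * Z" by blast
  obtain T where T1: "T \<in> carrier_mat k k" "d * P = P * T" using T[OF d] by blast
  obtain C where C: "C \<in> carrier_mat k k" "lie_bracket d z * P = P * C" "\<And>j. j < k \<Longrightarrow> col C j $ j = \<mu> (lie_bracket d z)"
    using T[OF br[OF d]] by blast
  have dc: "d \<in> carrier_mat m m" using d D by auto
  have "P * C = P * lie_bracket T Z"
    using lie_bracket_intertwine[OF P(1) dc z T1(1) Z(1) T1(2) Z(2)] C(2) by simp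
  then have "C = lie_bracket T Z" using inj_cols_cancel[OF P C(1)] T1 Z by simp
  \<comment> \<open>\<open>C\<close> is a commutator, yet all its \<open>k\<close> diagonal entries
    equal the weight; characteristic zero and \<open>k > 0\<close> force the weight to
    vanish.\<close>
  then have "mtrace C = 0" using mtrace_lie_bracket T1 Z by blast
  moreover have "mtrace C = of_nat k * \<mu> (lie_bracket d z)"
    using C(1,3) by (simp add: mtrace_def)
  ultimately show ?thesis using k0 by simp
qed

end

section \<open>Common eigenvectors\<close>

definition invariant_subspace :: "nat \<Rightarrow> complex mat set \<Rightarrow> complex vec set \<Rightarrow> bool" where
  "invariant_subspace m B S \<longleftrightarrow> subspace_vec m S \<and> (\<forall>x\<in>B. \<forall>v\<in>S. x *\<^sub>v v \<in> S)"

definition irreducible_set :: "nat \<Rightarrow> complex mat set \<Rightarrow> bool" where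
  "irreducible_set m B \<longleftrightarrow> (\<forall>S. invariant_subspace m B S \<longrightarrow> S = {0\<^sub>v m} \<or> S = carrier_vec m)"

lemma subspace_vec_eigenspace:
  assumes "D \<subseteq> carrier_mat m m"
  shows "subspace_vec m {v\<in>carrier_vec m. \<forall>d\<in>D. d *\<^sub>v v = \<mu> d \<cdot>\<^sub>v v}"
  unfolding subspace_vec_def
proof (intro conjI ballI allI; safe)
  fix d assume "d \<in> D"
  then have d: "d \<in> carrier_mat m m" using assms by auto
  show "d *\<^sub>v 0\<^sub>v m = \<mu> d \<cdot>\<^sub>v 0\<^sub>v m" using d by (intro eq_vecI) auto
  fix u v assume u: "u \<in> carrier_vec m" "\<forall>d\<in>D. d *\<^sub>v u = \<mu> d \<cdot>\<^sub>v u"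
  show "d *\<^sub>v (c \<cdot>\<^sub>v u) = \<mu> d \<cdot>\<^sub>v (c \<cdot>\<^sub>v u)" for c
    using u d \<open>d \<in> D\<close> by (simp add: mult_mat_vec[of _ m m] smult_smult_assoc mult.commute)
  assume v: "v \<in> carrier_vec m" "\<forall>d\<in>D. d *\<^sub>v v = \<mu> d \<cdot>\<^sub>v v"
  show "d *\<^sub>v (u + v) = \<mu> d \<cdot>\<^sub>v (u + v)" 
    using u v d \<open>d \<in> D\<close> by (simp add: mult_add_distrib_mat_vec[of _ m m] smult_add_distrib_vec[of _ m])
qed auto

lemma eigenvalue_exists:
  assumes "A \<in> carrier_mat m m" "m > 0"
  obtains c v where "v \<in> carrier_vec m" "v \<noteq> 0\<^sub>v m" "A *\<^sub>v v = (c::complex) \<cdot>\<^sub>v v"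
  using spectrum_non_empty[OF assms] assms(1) unfolding spectrum_def eigenvalue_def eigenvector_def by auto

lemma lie_bracket_mult_vec:
  assumes "a \<in> carrier_mat m m" "b \<in> carrier_mat m m" "v \<in> carrier_vec m"
  shows "a *\<^sub>v (b *\<^sub>v v) = b *\<^sub>v (a *\<^sub>v v) + lie_bracket a b *\<^sub>v v"
  unfolding lie_bracket_def using assms
  by (simp add: minus_mult_distrib_mat_vec[of _ m m] assoc_mult_mat_vec[of _ m m]) (intro eq_vecI; simp)

text \<open>The weight lemma makes the joint eigenspace \<open>S\<close> of \<open>D\<close>
  invariant under \<open>B\<close>, so it is the whole space and \<open>D\<close> acts by scalars. A
  bracket of elements of \<open>B\<close> is then scalar with trace zero, hence zero, so
  \<open>B\<close> commutes. Eigenspaces of a single \<open>x\<close> are now invariant too, and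
  irreducibility makes every \<open>x\<close> scalar.\<close>

lemma irreducible_common_eigenvector:
  assumes m: "m > 0" and B: "solvable_chain m (Suc k) B" and irr: "irreducible_set m B"
    and IH: "\<And>D. solvable_chain m k D \<Longrightarrow> \<exists>v\<in>carrier_vec m. v \<noteq> 0\<^sub>v m \<and> (\<forall>x\<in>D. \<exists>c. x *\<^sub>v v = c \<cdot>\<^sub>v v)"
  shows "\<exists>v\<in>carrier_vec m. v \<noteq> 0\<^sub>v m \<and> (\<forall>x\<in>B. \<exists>c. x *\<^sub>v v = c \<cdot>\<^sub>v v)"
proof -
  obtain D where D: "solvable_chain m k D" "D \<subseteq> B" "\<And>a b. a \<in> B \<Longrightarrow> b \<in> B \<Longrightarrow> lie_bracket a b \<in> D" using B by auto
  have Bc: "B \<subseteq> carrier_mat m m" using B by auto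
  obtain w \<mu> where w: "w \<in> carrier_vec m" "w \<noteq> 0\<^sub>v m" "\<And>d. d \<in> D \<Longrightarrow> d *\<^sub>v w = \<mu> d \<cdot>\<^sub>v w"
    using IH[OF D(1)] by metis
  define S where "S = {v\<in>carrier_vec m. \<forall>d\<in>D. d *\<^sub>v v = \<mu> d \<cdot>\<^sub>v v}"
  have "invariant_subspace m B S" unfolding invariant_subspace_def
  proof (intro conjI ballI)
    show "subspace_vec m S" unfolding S_def using subspace_vec_eigenspace D(2) Bc by blast
    fix x v assume x: "x \<in> B" and v: "v \<in> S"
    have xc: "x \<in> carrier_mat m m" using x Bc by auto
    have vc: "v \<in> carrier_vec m" and vD: "\<And>d. d \<in> D \<Longrightarrow> d *\<^sub>v v = \<mu> d \<cdot>\<^sub>v v" using v by (auto simp: S_def)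
    show "x *\<^sub>v v \<in> S" 
    \<comment> \<open>The weight lemma must start from a nonzero vector; it is applied to the orbit
      of \<open>v\<close> under \<open>x\<close>.\<close>
    proof (cases "v = 0\<^sub>v m")
      case True
      then have "x *\<^sub>v v = v" using xc by (intro eq_vecI) auto
      then show ?thesis using v by simp
    next
      case False
      have "d *\<^sub>v (x *\<^sub>v v) = \<mu> d \<cdot>\<^sub>v (x *\<^sub>v v)" if d: "d \<in> D" for d
      proof -
        have dc: "d \<in> carrier_mat m m" using d D Bc by auto
        define u where "u k = ((*\<^sub>v) x ^^ k) v" for k
        have br: "\<And>d. d \<in> D \<Longrightarrow> lie_bracket d x \<in> D" using D x by blast
        have "\<mu> (lie_bracket d x) = 0"
          by (rule weight_lie_bracket_eq_0[OF xc, of u D]) (use False vc vD br d D Bc in \<open>auto simp: u_def\<close>)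
        then have "lie_bracket d x *\<^sub>v v = 0\<^sub>v m" using vD[OF br[OF d]] vc by auto
        then show ?thesis using lie_bracket_mult_vec[OF dc xc vc] vD[OF d] vc xc
          by (simp add: mult_mat_vec[of _ m m])
      qed
      then show ?thesis unfolding S_def using xc vc by auto
    qed
  qed
  moreover have "w \<in> S" using w by (auto simp: S_def)
  ultimately have S: "S = carrier_vec m" using irr w(2) unfolding irreducible_set_def by blast
  have scal: "d = \<mu> d \<cdot>\<^sub>m 1\<^sub>m m" if d: "d \<in> D" for d
  proof (rule mat_col_eqI)
    have dc: "d \<in> carrier_mat m m" using d D Bc by auto
    fix j assume "j < dim_col (\<mu> d \<cdot>\<^sub>m 1\<^sub>m m)"
    then have j: "j < m" by simp
    have "d *\<^sub>v unit_vec m j = \<mu> d \<cdot>\<^sub>v unit_vec m j" using S d unfolding S_def by auto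
    then show "col d j = col (\<mu> d \<cdot>\<^sub>m 1\<^sub>m m) j" using dc j by (auto simp: mult_unit_vec)
  qed (use d D Bc in auto)
  have comm: "lie_bracket a b = 0\<^sub>m m m" if ab: "a \<in> B" "b \<in> B" for a b
  proof -
    have "mtrace (lie_bracket a b) = 0" using mtrace_lie_bracket ab Bc by blast
    moreover have "mtrace (lie_bracket a b) = of_nat m * \<mu> (lie_bracket a b)"
      by (subst scal[OF D(3)[OF ab]]) (simp add: mtrace_def)
    ultimately have "\<mu> (lie_bracket a b) = 0" using m by simp
    then show ?thesis using scal[OF D(3)[OF ab]] by auto
  qed
  have "\<exists>c. \<forall>v\<in>carrier_vec m. x *\<^sub>v v = c \<cdot>\<^sub>v v" if x: "x \<in> B" for x
  proof -
    have xc: "x \<in> carrier_mat m m" using x Bc by auto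
    obtain c v where v: "v \<in> carrier_vec m" "v \<noteq> 0\<^sub>v m" "x *\<^sub>v v = c \<cdot>\<^sub>v v"
      using eigenvalue_exists[OF xc m] .
    define E where "E = {v\<in>carrier_vec m. \<forall>d\<in>{x}. d *\<^sub>v v = c \<cdot>\<^sub>v v}"
    have "invariant_subspace m B E" unfolding invariant_subspace_def
    proof (intro conjI ballI)
      show "subspace_vec m E" unfolding E_def using subspace_vec_eigenspace[of "{x}" m "\<lambda>_. c"] xc by blast
      fix y v assume y: "y \<in> B" and v: "v \<in> E"
      have yc: "y \<in> carrier_mat m m" using y Bc by auto
      have vc: "v \<in> carrier_vec m" "x *\<^sub>v v = c \<cdot>\<^sub>v v" using v by (auto simp: E_def)
      have "x *\<^sub>v (y *\<^sub>v v) = y *\<^sub>v (c \<cdot>\<^sub>v v)"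
        using lie_bracket_mult_vec[OF xc yc vc(1)] comm[OF x y] vc yc zero_mult_vec[OF vc(1), of m] by simp
      then show "y *\<^sub>v v \<in> E" using vc yc by (auto simp: E_def mult_mat_vec[of _ m m])
    qed
    moreover have "v \<in> E" using v by (auto simp: E_def)
    ultimately have "E = carrier_vec m" using irr v(2) unfolding irreducible_set_def by blast
    then show ?thesis unfolding E_def by blast
  qed
  then show ?thesis using w(1,2) by metis
qed

text \<open>\<open>P\<close> spans a nonzero invariant subspace of least dimension. An invariant
  subspace of the restriction with basis \<open>R\<close> yields the one spanned by
  \<open>P * R\<close>, so \<open>R\<close> has no column or as many as \<open>P\<close>.\<close>

lemma exists_irreducible_restriction:
  assumes m: "m > 0" and B: "B \<subseteq> carrier_mat m m"
  obtains r P h where "r > 0" "P \<in> carrier_mat m r" "inj_cols P"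
    "\<And>x. x \<in> B \<Longrightarrow> h x \<in> carrier_mat r r \<and> x * P = P * h x" "irreducible_set r (h ` B)"
proof -
  define Q where "Q r \<longleftrightarrow> r > 0 \<and> (\<exists>P\<in>carrier_mat m r. inj_cols P \<and> (\<forall>x\<in>B. \<exists>X\<in>carrier_mat r r. x * P = P * X))" for r
  have "Q m" unfolding Q_def using m B
    by (intro conjI bexI[of _ "1\<^sub>m m"]) (auto intro: inj_colsI[of _ m m])
  then obtain r where r: "Q r" "\<And>j. j < r \<Longrightarrow> \<not> Q j" using exists_least_iff[of Q] by blast
  then obtain P where P: "P \<in> carrier_mat m r" "inj_cols P" and "\<forall>x\<in>B. \<exists>X\<in>carrier_mat r r. x * P = P * X"
    unfolding Q_def by blast
  then obtain h where h: "\<And>x. x \<in> B \<Longrightarrow> h x \<in> carrier_mat r r \<and> x * P = P * h x" by metis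
  have "S = {0\<^sub>v r} \<or> S = carrier_vec r" if S: "invariant_subspace r (h ` B) S" for S
  proof -
    obtain k R where R: "R \<in> carrier_mat r k" "inj_cols R" "S = {R *\<^sub>v v | v. v \<in> carrier_vec k}"
      using subspace_vec_basis S unfolding invariant_subspace_def by blast
    have ex: "\<exists>X\<in>carrier_mat k k. x * (P * R) = P * R * X" if x: "x \<in> B" for x
    proof -
      have "\<exists>X\<in>carrier_mat k k. h x * R = R * X \<and> (\<forall>j<k. True)"
      proof (rule factor_through_cols[OF R(1)])
        show "h x * R \<in> carrier_mat r k" using h[OF x] R by auto
        fix j assume j: "j < k"
        have "col R j = R *\<^sub>v unit_vec k j" using R j by (simp add: mult_unit_vec)
        then have "col R j \<in> S" using R(3) j by auto
        then have "h x *\<^sub>v col R j \<in> S" using S x unfolding invariant_subspace_def by blast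
        then show "\<exists>v\<in>carrier_vec k. col (h x * R) j = R *\<^sub>v v \<and> True"
          using R(3) mult_col_eq[OF _ R(1) j] h[OF x] by auto
      qed
      then obtain X where X: "X \<in> carrier_mat k k" "h x * R = R * X" by blast
      have xc: "x \<in> carrier_mat m m" using x B by auto
      have "x * (P * R) = P * (h x * R)" using assoc_mult_mat[OF xc P(1) R(1)] assoc_mult_mat[OF P(1) _ R(1), of "h x"] h[OF x] by simp
      then show ?thesis using X P R by (intro bexI[of _ X]) (auto simp: assoc_mult_mat[of _ m r _ k _ k])
    qed
    show ?thesis
    proof (cases "k = 0")
      case True
      have z: "R *\<^sub>v v = 0\<^sub>v r" if "v \<in> carrier_vec k" for v
        using that R(1) True by (intro eq_vecI) (auto simp: scalar_prod_def)
      then have "S \<subseteq> {0\<^sub>v r}" unfolding R(3) by blast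
      moreover have "0\<^sub>v r \<in> S" using S unfolding invariant_subspace_def subspace_vec_def by blast
      ultimately show ?thesis by blast
    next
      case False
      have "Q k" unfolding Q_def using False P R ex inj_cols_mult[OF P R(1,2)]
        by (intro conjI bexI[of _ "P * R"]) auto
      then have "k = r" using r(2)[of k] inj_cols_dim_le[OF R(1,2)] by force
      then obtain R' where R': "inv_pair r R R'" using inv_pair_of_inj_cols R by blast
      have "v \<in> S" if v: "v \<in> carrier_vec r" for v
      proof -
        have "v = R *\<^sub>v (R' *\<^sub>v v)" using R' v assoc_mult_mat_vec[of R r r R' r v] unfolding inv_pair_def by simp
        moreover have "R' *\<^sub>v v \<in> carrier_vec k" using R' v \<open>k = r\<close> mult_mat_vec_carrier[of R' r r v] unfolding inv_pair_def by blast
        ultimately show ?thesis unfolding R(3) by blast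
      qed
      then show ?thesis using S unfolding invariant_subspace_def subspace_vec_def by blast
    qed
  qed
  then show ?thesis using that[of r P h] r(1) P h unfolding Q_def irreducible_set_def by blast
qed

text \<open>Induction on the length of the chain, for all dimensions together: the hypothesis is
  applied in the dimension of the irreducible restriction. An eigenvector found there is carried
  back by \<open>P\<close>.\<close>

theorem slv_common_eigenvector:
  assumes "m > 0" "solvable_chain m k B"
  shows "\<exists>v\<in>carrier_vec m. v \<noteq> 0\<^sub>v m \<and> (\<forall>x\<in>B. \<exists>c. x *\<^sub>v v = c \<cdot>\<^sub>v v)"
  using assms
proof (induction k arbitrary: m B)
  case 0
  have "0\<^sub>m m m *\<^sub>v unit_vec m 0 = 0 \<cdot>\<^sub>v (unit_vec m 0 :: complex vec)" by (intro eq_vecI) auto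
  then show ?case using 0 by (intro bexI[of _ "unit_vec m 0"]) (auto intro!: exI[of _ 0])
next
  case (Suc k)
  have Bc: "B \<subseteq> carrier_mat m m" using solvable_chain_carrier Suc.prems by blast
  obtain r P h where r: "r > 0" and P: "P \<in> carrier_mat m r" "inj_cols P"
    and h: "\<And>x. x \<in> B \<Longrightarrow> h x \<in> carrier_mat r r \<and> x * P = P * h x" and irr: "irreducible_set r (h ` B)"
    using exists_irreducible_restriction[OF Suc.prems(1) Bc] by blast
  \<comment> \<open>The restrictions \<open>h x\<close> were only chosen one by one; independence of
    the columns of \<open>P\<close> makes them unique, hence compatible with brackets.\<close>
  have unique: "h x = X" if "x \<in> B" "X \<in> carrier_mat r r" "x * P = P * X" for x X
    using inj_cols_cancel[OF P, of "h x" r X] h[OF that(1)] that by simp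
  obtain D where D: "solvable_chain m k D" "D \<subseteq> B" "\<And>a b. a \<in> B \<Longrightarrow> b \<in> B \<Longrightarrow> lie_bracket a b \<in> D" using Suc.prems by auto
  have lieB: "h (lie_bracket a b) = lie_bracket (h a) (h b)" if ab: "a \<in> B" "b \<in> B" for a b
  proof (rule unique)
    show "lie_bracket a b \<in> B" using D ab by blast
    show "lie_bracket (h a) (h b) \<in> carrier_mat r r" using h ab by simp
    have "a \<in> carrier_mat m m" "b \<in> carrier_mat m m" using ab Bc by auto
    then show "lie_bracket a b * P = P * lie_bracket (h a) (h b)"
      using lie_bracket_intertwine[OF P(1)] h ab by simp
  qed
  have "solvable_chain r (Suc k) (h ` B)"
  \<comment> \<open>\<open>B\<close> is a mere set and may lack the zero matrix. But any
    \<open>a\<close> in \<open>B\<close> puts the zero matrix \<open>lie_bracket a a\<close> into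
    \<open>D\<close>, hence into \<open>B\<close>, so only the empty set is left.\<close>
  proof (cases "0\<^sub>m m m \<in> B")
    case True
    have "h (0\<^sub>m m m) = 0\<^sub>m r r" using P by (intro unique[OF True]) auto
    then show ?thesis using solvable_chain_image[OF Suc.prems(2)] lieB h by blast
  next
    case False
    have "B = {}"
    proof (rule ccontr)
      assume "B \<noteq> {}"
      then obtain a where a: "a \<in> B" by blast
      then have "lie_bracket a a \<in> B" using D by blast
      moreover have "lie_bracket a a = 0\<^sub>m m m" using a Bc by (auto simp: lie_bracket_def)
      ultimately show False using False by simp
    qed
    then show ?thesis by (simp add: solvable_chain_empty)
  qed
  then obtain v where v: "v \<in> carrier_vec r" "v \<noteq> 0\<^sub>v r" "\<And>x. x \<in> B \<Longrightarrow> \<exists>c. h x *\<^sub>v v = c \<cdot>\<^sub>v v"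
    using irreducible_common_eigenvector[OF r _ irr Suc.IH[OF r]] by blast
  have "P *\<^sub>v v \<noteq> 0\<^sub>v m" using inj_colsD[OF P(2,1) v(1)] v(2) by blast
  moreover have "\<exists>c. x *\<^sub>v (P *\<^sub>v v) = c \<cdot>\<^sub>v (P *\<^sub>v v)" if x: "x \<in> B" for x
  proof -
    obtain c where c: "h x *\<^sub>v v = c \<cdot>\<^sub>v v" using v x by blast
    have "x \<in> carrier_mat m m" using x Bc by auto
    then have "x *\<^sub>v (P *\<^sub>v v) = P *\<^sub>v (h x *\<^sub>v v)" using assoc_mult_mat_vec[OF _ P(1) v(1), of x m] assoc_mult_mat_vec[OF P(1) _ v(1), of "h x"] h[OF x] by simp
    then show ?thesis using c mult_mat_vec[OF P(1) v(1)] by auto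
  qed
  ultimately show ?case using P v by (intro bexI[of _ "P *\<^sub>v v"]) auto
qed

section \<open>Simultaneous triangularization\<close>

lemma inv_pair_mult:
  assumes "inv_pair N g h" "inv_pair N g' h'"
  shows "inv_pair N (g * g') (h' * h)"
proof -
  have c: "g \<in> carrier_mat N N" "h \<in> carrier_mat N N" "g' \<in> carrier_mat N N" "h' \<in> carrier_mat N N"
    using assms by (auto simp: inv_pair_def)
  have "(g * g') * (h' * h) = g * (g' * h') * h" using c by (simp add: assoc_mult_mat[of _ N N _ N _ N])
  moreover have "(h' * h) * (g * g') = h' * (h * g) * g'" using c by (simp add: assoc_mult_mat[of _ N N _ N _ N])
  ultimately show ?thesis using assms c by (simp add: inv_pair_def)
qed

lemma inv_pair_sym: "inv_pair N g h \<Longrightarrow> inv_pair N h g"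
  by (auto simp: inv_pair_def)

lemma inv_pair_carrier:
  assumes "inv_pair N g h"
  shows "g \<in> carrier_mat N N" "h \<in> carrier_mat N N"
  using assms by (auto simp: inv_pair_def)

lemma inv_pair_cancel:
  assumes gh: "inv_pair N g h" and x: "x \<in> carrier_mat N l"
  shows "g * (h * x) = x" "h * (g * x) = x"
  using gh x assoc_mult_mat[of g N N h N x l] assoc_mult_mat[of h N N g N x l] by (auto simp: inv_pair_def)

lemma lie_bracket_conj:
  assumes gh: "inv_pair N g h" and x: "x \<in> carrier_mat N N" and y: "y \<in> carrier_mat N N"
  shows "h * lie_bracket x y * g = lie_bracket (h * x * g) (h * y * g)"
proof -
  note c = inv_pair_carrier[OF gh]
  have "lie_bracket x y * g = g * lie_bracket (h * x * g) (h * y * g)"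
  proof (rule lie_bracket_intertwine[OF c(1) x y])
    show "x * g = g * (h * x * g)" using c x inv_pair_cancel[OF gh, of "x * g" N] by (simp add: assoc_mult_mat[of h N N _ N _ N])
    show "y * g = g * (h * y * g)" using c y inv_pair_cancel[OF gh, of "y * g" N] by (simp add: assoc_mult_mat[of h N N _ N _ N])
  qed (use c x y in auto)
  then have "h * (lie_bracket x y * g) = lie_bracket (h * x * g) (h * y * g)"
    using inv_pair_cancel(2)[OF gh, of "lie_bracket (h * x * g) (h * y * g)" N] c x y
    by (metis lie_bracket_carrier mult_carrier_mat)
  moreover have "h * lie_bracket x y * g = h * (lie_bracket x y * g)"
    using c x y by (intro assoc_mult_mat[of h N N _ N _ N]) auto
  ultimately show ?thesis by simp
qed

text \<open>If \<open>v $ i\<close> is nonzero, \<open>v\<close> can replace the \<open>i\<close>-th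
  unit vector. \<open>insert_index i\<close> enumerates the indices other than \<open>i\<close>, so
  the remaining unit vectors fill the columns after the first.\<close>

lemma complete_to_basis:
  assumes v: "v \<in> carrier_vec (Suc N)" "v \<noteq> 0\<^sub>v (Suc N)"
  shows "\<exists>g h. inv_pair (Suc N) g h \<and> col g 0 = v"
proof -
  obtain i where i: "i < Suc N" "v $ i \<noteq> 0"
    using v by (metis eq_vecI carrier_vecD index_zero_vec)
  define g where "g = mat (Suc N) (Suc N) (\<lambda>(a,b). if b = 0 then v $ a else if a = insert_index i (b - 1) then 1 else 0)"
  have g: "g \<in> carrier_mat (Suc N) (Suc N)" by (simp add: g_def)
  have "inj_cols g"
  proof (rule inj_colsI[OF g])
    fix x assume x: "x \<in> carrier_vec (Suc N)" and 0: "g *\<^sub>v x = 0\<^sub>v (Suc N)"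
    have row: "v $ a * x $ 0 + (\<Sum>b<N. if a = insert_index i b then x $ Suc b else 0) = 0" if a: "a < Suc N" for a
    proof -
      have "0 = (g *\<^sub>v x) $ a" using a 0 by simp
      also have "\<dots> = (\<Sum>b=0..<Suc N. (if b = 0 then v $ a else if a = insert_index i (b - 1) then 1 else 0) * x $ b)"
        using a x by (simp add: g_def scalar_prod_def)
      also have "\<dots> = v $ a * x $ 0 + (\<Sum>b<N. if a = insert_index i b then x $ Suc b else 0)"
        by (subst sum.atLeast0_lessThan_Suc_shift) (auto simp: atLeast0LessThan intro!: sum.cong)
      finally show ?thesis by simp
    qed
    have "(\<Sum>b<N. if i = insert_index i b then x $ Suc b else 0) = 0"
      by (intro sum.neutral) (auto simp: insert_index_def)
    then have x0: "x $ 0 = 0" using row[OF i(1)] i(2) by simp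
    have xS: "x $ Suc j = 0" if j: "j < N" for j
    proof -
      have "(\<Sum>b<N. if insert_index i j = insert_index i b then x $ Suc b else 0) = (\<Sum>b<N. if j = b then x $ Suc b else 0)"
        by (intro sum.cong refl) (auto simp: insert_index_def split: if_splits)
      then show ?thesis using row[of "insert_index i j"] x0 j by (simp add: insert_index_def)
    qed
    show "x = 0\<^sub>v (Suc N)"
    proof (rule eq_vecI)
      fix j assume "j < dim_vec (0\<^sub>v (Suc N) :: complex vec)"
      then show "x $ j = 0\<^sub>v (Suc N) $ j" using x0 xS by (cases j) auto
    qed (use x in simp)
  qed
  moreover have "col g 0 = v" using v by (intro eq_vecI) (auto simp: g_def)
  ultimately show ?thesis using inv_pair_of_inj_cols[OF g] by blast
qed

text \<open>The action on the quotient by the first basis vector, when that vector is an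
  eigenvector.\<close>

definition lower_block :: "nat \<Rightarrow> complex mat \<Rightarrow> complex mat" where
  "lower_block N y = mat N N (\<lambda>(i,j). y $$ (Suc i, Suc j))"

lemma lower_block_carrier[simp]: "lower_block N y \<in> carrier_mat N N"
  by (simp add: lower_block_def)

lemma lower_block_mult:
  assumes x: "x \<in> carrier_mat (Suc N) (Suc N)" "\<And>i. i < N \<Longrightarrow> x $$ (Suc i, 0) = 0" and y: "y \<in> carrier_mat (Suc N) (Suc N)"
  shows "lower_block N (x * y) = lower_block N x * lower_block N y"
proof (rule eq_matI)
  fix i j assume "i < dim_row (lower_block N x * lower_block N y)" "j < dim_col (lower_block N x * lower_block N y)"
  then have ij: "i < N" "j < N" by (auto simp: lower_block_def)
  have "lower_block N (x * y) $$ (i,j) = (\<Sum>l=0..<Suc N. x $$ (Suc i, l) * y $$ (l, Suc j))"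
    using ij x y by (simp add: lower_block_def scalar_prod_def)
  also have "\<dots> = (\<Sum>l=0..<N. x $$ (Suc i, Suc l) * y $$ (Suc l, Suc j))"
    by (subst sum.atLeast0_lessThan_Suc_shift) (simp add: x(2) ij)
  also have "\<dots> = (lower_block N x * lower_block N y) $$ (i,j)"
    using ij by (simp add: lower_block_def scalar_prod_def)
  finally show "lower_block N (x * y) $$ (i,j) = (lower_block N x * lower_block N y) $$ (i,j)" .
qed (auto simp: lower_block_def)

lemma lower_block_lie_bracket:
  assumes x: "x \<in> carrier_mat (Suc N) (Suc N)" "\<And>i. i < N \<Longrightarrow> x $$ (Suc i, 0) = 0" 
    and y: "y \<in> carrier_mat (Suc N) (Suc N)" "\<And>i. i < N \<Longrightarrow> y $$ (Suc i, 0) = 0" 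
  shows "lower_block N (lie_bracket x y) = lie_bracket (lower_block N x) (lower_block N y)"
proof -
  have "lower_block N (x * y - y * x) = lower_block N (x * y) - lower_block N (y * x)"
    using x(1) y(1) by (intro eq_matI) (auto simp: lower_block_def)
  then show ?thesis unfolding lie_bracket_def using lower_block_mult[OF x y(1)] lower_block_mult[OF y x(1)] by simp
qed

lemma block_decomp:
  assumes "y \<in> carrier_mat (Suc N) (Suc N)" "\<And>i. i < N \<Longrightarrow> y $$ (Suc i, 0) = 0"
  shows "y = four_block_mat (mat 1 1 (\<lambda>_. y $$ (0,0))) (mat 1 N (\<lambda>(i,j). y $$ (0, Suc j))) (0\<^sub>m N 1) (lower_block N y)"
proof (rule eq_matI)
  fix i j
  assume "i < dim_row (four_block_mat (mat 1 1 (\<lambda>_. y $$ (0,0))) (mat 1 N (\<lambda>(i,j). y $$ (0, Suc j))) (0\<^sub>m N 1) (lower_block N y))"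
    "j < dim_col (four_block_mat (mat 1 1 (\<lambda>_. y $$ (0,0))) (mat 1 N (\<lambda>(i,j). y $$ (0, Suc j))) (0\<^sub>m N 1) (lower_block N y))"
  then have "i < Suc N" "j < Suc N" by (auto simp: lower_block_def)
  then show "y $$ (i,j) = four_block_mat (mat 1 1 (\<lambda>_. y $$ (0,0))) (mat 1 N (\<lambda>(i,j). y $$ (0, Suc j))) (0\<^sub>m N 1) (lower_block N y) $$ (i,j)"
    using assms by (cases i; cases j) (auto simp: lower_block_def)
qed (use assms in \<open>auto simp: lower_block_def\<close>)

lemma block_diag_conj:
  fixes A :: "complex mat"
  assumes A: "A \<in> carrier_mat 1 1" and R: "R \<in> carrier_mat 1 N" and L: "L \<in> carrier_mat N N"
    and a: "a \<in> carrier_mat N N" and b: "b \<in> carrier_mat N N"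
  shows "four_block_mat (1\<^sub>m 1) (0\<^sub>m 1 N) (0\<^sub>m N 1) a * four_block_mat A R (0\<^sub>m N 1) L
    * four_block_mat (1\<^sub>m 1) (0\<^sub>m 1 N) (0\<^sub>m N 1) b = four_block_mat A (R * b) (0\<^sub>m N 1) (a * L * b)"
proof -
  have "four_block_mat (1\<^sub>m 1) (0\<^sub>m 1 N) (0\<^sub>m N 1) a * four_block_mat A R (0\<^sub>m N 1) L
      = four_block_mat A R (0\<^sub>m N 1) (a * L)"
    using A R L a by (subst mult_four_block_mat[of _ 1 1 _ N _ N _ _ 1 _ N]) auto
  also have "\<dots> * four_block_mat (1\<^sub>m 1) (0\<^sub>m 1 N) (0\<^sub>m N 1) b = four_block_mat A (R * b) (0\<^sub>m N 1) (a * L * b)"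
    using A R L a b by (subst mult_four_block_mat[of _ 1 1 _ N _ N _ _ 1 _ N]) auto
  finally show ?thesis .
qed

text \<open>A common eigenvector becomes the first basis vector. The induced matrices on the
  quotient again have a chain, and a triangularizing basis found there is extended by
  \<open>E\<close>, a block matrix with leading entry 1.\<close>

theorem solvable_chain_triangularizable:
  assumes "solvable_chain N k B"
  shows "\<exists>g h. inv_pair N g h \<and> (\<forall>x\<in>B. upper_triangular (h * x * g))"
  using assms
proof (induction N arbitrary: B)
  case 0
  have "inv_pair 0 (1\<^sub>m 0) (1\<^sub>m 0)" by (simp add: inv_pair_def)
  then show ?case by (intro exI[of _ "1\<^sub>m 0"]) (auto intro!: upper_triangularI)
next
  case (Suc N)
  have Bc: "B \<subseteq> carrier_mat (Suc N) (Suc N)" using solvable_chain_carrier Suc.prems by blast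
  obtain v where v: "v \<in> carrier_vec (Suc N)" "v \<noteq> 0\<^sub>v (Suc N)" "\<And>x. x \<in> B \<Longrightarrow> \<exists>c. x *\<^sub>v v = c \<cdot>\<^sub>v v"
    using slv_common_eigenvector[OF _ Suc.prems] by blast
  obtain g h where gh: "inv_pair (Suc N) g h" and col: "col g 0 = v" using complete_to_basis[OF v(1,2)] by blast
  note c = inv_pair_carrier[OF gh]
  \<comment> \<open>\<open>v\<close> is the first column of \<open>g\<close>, so \<open>h\<close>
    sends it to the first unit vector, and the eigenvector equation clears the first column below
    the diagonal.\<close>
  have e0: "(h * x * g) $$ (Suc i, 0) = 0" if x: "x \<in> B" and i: "i < N" for x i
  proof -
    have xc: "x \<in> carrier_mat (Suc N) (Suc N)" using x Bc by auto
    obtain d where d: "x *\<^sub>v v = d \<cdot>\<^sub>v v" using v x by blast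
    have "col (h * x * g) 0 = h * x *\<^sub>v v" using mult_col_eq[of "h * x" "Suc N" "Suc N" g "Suc N" 0] c xc col by simp
    also have "\<dots> = d \<cdot>\<^sub>v (h *\<^sub>v v)" using c xc v(1) d by (simp add: assoc_mult_mat_vec[of _ "Suc N" "Suc N"] mult_mat_vec[of _ "Suc N" "Suc N"])
    also have "h *\<^sub>v v = col (h * g) 0" using mult_col_eq[of h "Suc N" "Suc N" g "Suc N" 0] c col by simp
    also have "h * g = 1\<^sub>m (Suc N)" using gh by (simp add: inv_pair_def)
    finally have "col (h * x * g) 0 $ Suc i = 0" using i by simp
    then show ?thesis using c xc i by simp
  qed
  define \<phi> where "\<phi> x = lower_block N (h * x * g)" for x
  have "solvable_chain N k (\<phi> ` B)"
  proof (rule solvable_chain_image[OF Suc.prems])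
    show "\<phi> (0\<^sub>m (Suc N) (Suc N)) = 0\<^sub>m N N" using c by (auto simp: \<phi>_def lower_block_def)
    fix a b assume ab: "a \<in> B" "b \<in> B"
    then have abc: "a \<in> carrier_mat (Suc N) (Suc N)" "b \<in> carrier_mat (Suc N) (Suc N)" using Bc by auto
    show "\<phi> (lie_bracket a b) = lie_bracket (\<phi> a) (\<phi> b)"
      unfolding \<phi>_def lie_bracket_conj[OF gh abc]
      by (rule lower_block_lie_bracket[OF _ e0[OF ab(1)] _ e0[OF ab(2)]]) (use abc c in auto)
  qed (simp add: \<phi>_def)
  then obtain g1 h1 where gh1: "inv_pair N g1 h1" and ut: "\<And>x. x \<in> B \<Longrightarrow> upper_triangular (h1 * \<phi> x * g1)"
    using Suc.IH by blast
  note c1 = inv_pair_carrier[OF gh1]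
  define E where "E a = four_block_mat (1\<^sub>m 1) (0\<^sub>m 1 N) (0\<^sub>m N 1) a" for a :: "complex mat"
  have Ec: "E a \<in> carrier_mat (Suc N) (Suc N)" if "a \<in> carrier_mat N N" for a
    using that four_block_carrier_mat[of "1\<^sub>m 1" 1 1 a N N] by (simp add: E_def)
  have Emult: "E a * E b = E (a * b)" if "a \<in> carrier_mat N N" "b \<in> carrier_mat N N" for a b
    unfolding E_def using that by (subst mult_four_block_mat[of _ 1 1 _ N _ N]) auto
  have E1: "E (1\<^sub>m N) = 1\<^sub>m (Suc N)" unfolding E_def using four_block_one_mat[of 1 N] by simp
  have EE: "inv_pair (Suc N) (E g1) (E h1)"
    using Ec Emult E1 c1 gh1 by (auto simp: inv_pair_def)
  have "upper_triangular (E h1 * h * x * (g * E g1))" if x: "x \<in> B" for x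
  proof -
    have xc: "x \<in> carrier_mat (Suc N) (Suc N)" using x Bc by auto
    define y where "y = h * x * g"
    have yc: "y \<in> carrier_mat (Suc N) (Suc N)" using c xc by (simp add: y_def)
    have "E h1 * h * x * (g * E g1) = E h1 * y * E g1"
      unfolding y_def using c xc Ec c1 by (simp add: assoc_mult_mat[of _ "Suc N" "Suc N" _ "Suc N" _ "Suc N"])
    also have "\<dots> = four_block_mat (mat 1 1 (\<lambda>_. y $$ (0,0))) (mat 1 N (\<lambda>(i,j). y $$ (0, Suc j)) * g1) (0\<^sub>m N 1) (h1 * \<phi> x * g1)"
      unfolding E_def \<phi>_def y_def[symmetric] using c1 e0[OF x]
      by (subst block_decomp[OF yc]) (simp add: y_def, intro block_diag_conj, auto)
    finally have eq: "E h1 * h * x * (g * E g1) = four_block_mat (mat 1 1 (\<lambda>_. y $$ (0,0))) (mat 1 N (\<lambda>(i,j). y $$ (0, Suc j)) * g1) (0\<^sub>m N 1) (h1 * \<phi> x * g1)" .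
    show ?thesis unfolding eq
      by (rule upper_triangular_four_block[OF _ _ _ ut[OF x]]) (use c1 in \<open>auto simp: \<phi>_def intro!: mult_carrier_mat[of _ N N]\<close>)
  qed
  then show ?case using inv_pair_mult[OF gh EE] by blast
qed

section \<open>Borel subalgebras are conjugate to the upper triangular matrices\<close>

text \<open>The filtration by superdiagonals: \<open>k = 0\<close> gives the upper triangular
  matrices, \<open>k = 1\<close> the strictly upper triangular ones, and \<open>k = N\<close> only
  zero. It bounds the derived series.\<close>

definition tri_mats :: "nat \<Rightarrow> nat \<Rightarrow> complex mat set" where
  "tri_mats N k = {U \<in> carrier_mat N N. \<forall>i<N. \<forall>j<N. j < i + k \<longrightarrow> U $$ (i,j) = 0}"

lemma csubspace_tri_mats: "csubspace_gl N (tri_mats N k)"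
  by (auto simp: csubspace_gl_def tri_mats_def)

lemma index_mult_mat_sum:
  assumes "A \<in> carrier_mat n m" "B \<in> carrier_mat m l" "i < n" "j < l"
  shows "(A * B) $$ (i,j) = (\<Sum>k<m. A $$ (i,k) * B $$ (k,j))"
  using assms by (simp add: scalar_prod_def atLeast0LessThan)

lemma tri_mats_mult:
  assumes "A \<in> tri_mats N k" "B \<in> tri_mats N l"
  shows "A * B \<in> tri_mats N (k + l)"
proof -
  have c: "A \<in> carrier_mat N N" "B \<in> carrier_mat N N" using assms by (auto simp: tri_mats_def)
  have "(A * B) $$ (i,j) = 0" if ij: "i < N" "j < N" "j < i + (k + l)" for i j
    unfolding index_mult_mat_sum[OF c ij(1,2)]
  proof (intro sum.neutral ballI)
    fix r assume "r \<in> {..<N}"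
    then show "A $$ (i,r) * B $$ (r,j) = 0"
      using assms ij by (cases "r < i + k") (auto simp: tri_mats_def)
  qed
  then show ?thesis using c by (auto simp: tri_mats_def)
qed

lemma tri_mats_mono: "k \<le> l \<Longrightarrow> tri_mats N l \<subseteq> tri_mats N k"
  by (auto simp: tri_mats_def)

lemma tri_mats_mult_diag:
  assumes "A \<in> tri_mats N 0" "B \<in> tri_mats N 0" "i < N"
  shows "(A * B) $$ (i,i) = A $$ (i,i) * B $$ (i,i)"
proof -
  have c: "A \<in> carrier_mat N N" "B \<in> carrier_mat N N" using assms by (auto simp: tri_mats_def)
  have "(A * B) $$ (i,i) = (\<Sum>r<N. if r = i then A $$ (i,i) * B $$ (i,i) else 0)"
    unfolding index_mult_mat_sum[OF c assms(3,3)]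
  proof (intro sum.cong refl)
    fix r assume "r \<in> {..<N}"
    then show "A $$ (i,r) * B $$ (r,i) = (if r = i then A $$ (i,i) * B $$ (i,i) else 0)"
      using assms by (cases r i rule: linorder_cases) (auto simp: tri_mats_def)
  qed
  then show ?thesis using assms(3) by simp
qed

text \<open>For \<open>k > 0\<close> each product alone lies in level \<open>k + k\<close>, which is
  at least \<open>Suc k\<close>. For \<open>k = 0\<close> the gain comes from the commutator: both
  products have the same diagonal.\<close>

lemma tri_mats_lie_bracket:
  assumes "A \<in> tri_mats N k" "B \<in> tri_mats N k"
  shows "lie_bracket A B \<in> tri_mats N (Suc k)"
proof (cases "k = 0")
  case False
  have c: "A * B \<in> carrier_mat N N" "B * A \<in> carrier_mat N N" using assms by (auto simp: tri_mats_def)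
  have "A * B \<in> tri_mats N (Suc k)" "B * A \<in> tri_mats N (Suc k)"
    using tri_mats_mult[OF assms] tri_mats_mult[OF assms(2,1)] tri_mats_mono[of "Suc k" "k + k" N] False by auto
  then have "(A * B - B * A) $$ (i,j) = 0" if "i < N" "j < N" "j < i + Suc k" for i j
    using that c by (auto simp: tri_mats_def simp del: index_mult_mat)
  moreover have "A * B - B * A \<in> carrier_mat N N" by (rule minus_carrier_mat[OF c(2)])
  ultimately show ?thesis by (auto simp: lie_bracket_def tri_mats_def simp del: index_mult_mat)
next
  case True
  have c: "A \<in> carrier_mat N N" "B \<in> carrier_mat N N" using assms by (auto simp: tri_mats_def)
  have "(A * B - B * A) $$ (i,j) = 0" if ij: "i < N" "j < N" "j < Suc i" for i j
  proof (cases "j = i")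
    case True
    have "(A * B) $$ (i,i) = (B * A) $$ (i,i)"
      using tri_mats_mult_diag assms \<open>k = 0\<close> ij(1) by (metis mult.commute)
    then show ?thesis using True ij c by auto
  next
    case False
    then have "(A * B) $$ (i,j) = 0" "(B * A) $$ (i,j) = 0"
      using tri_mats_mult[OF assms] tri_mats_mult[OF assms(2,1)] \<open>k = 0\<close> ij by (auto simp: tri_mats_def)
    moreover have "(A * B - B * A) $$ (i,j) = (A * B) $$ (i,j) - (B * A) $$ (i,j)" using c ij by auto
    ultimately show ?thesis by simp
  qed
  moreover have "A * B - B * A \<in> carrier_mat N N" using c by auto
  ultimately show ?thesis unfolding lie_bracket_def tri_mats_def using True by auto
qed

definition conj_by :: "complex mat \<Rightarrow> complex mat \<Rightarrow> complex mat set \<Rightarrow> complex mat set" where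
  "conj_by g h S = (\<lambda>U. g * U * h) ` S"

lemma csubspace_conj_by:
  assumes gh: "inv_pair N g h" and S: "csubspace_gl N S"
  shows "csubspace_gl N (conj_by g h S)"
proof -
  note c = inv_pair_carrier[OF gh]
  have Sc: "U \<in> carrier_mat N N" if "U \<in> S" for U using S that by (auto simp: csubspace_gl_def)
  have 1: "g * U * h + g * V * h = g * (U + V) * h" if "U \<in> S" "V \<in> S" for U V
    using c Sc[OF that(1)] Sc[OF that(2)] by (simp add: add_mult_distrib_mat[of _ N N] mult_add_distrib_mat[of _ N N])
  have 2: "a \<cdot>\<^sub>m (g * U * h) = g * (a \<cdot>\<^sub>m U) * h" if "U \<in> S" for U a
    using c Sc[OF that] by (simp add: mult_smult_distrib[of _ N N] mult_smult_assoc_mat[of _ N N])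
  have 3: "g * 0\<^sub>m N N * h = 0\<^sub>m N N" using c by simp
  have 4: "g * U * h \<in> carrier_mat N N" if "U \<in> S" for U using c Sc[OF that] by simp
  show ?thesis unfolding csubspace_gl_def conj_by_def
  proof (intro conjI ballI allI)
    show "0\<^sub>m N N \<in> (\<lambda>U. g * U * h) ` S" using 3 S unfolding csubspace_gl_def by (metis imageI)
    show "(\<lambda>U. g * U * h) ` S \<subseteq> carrier_mat N N" using 4 by auto
    fix a assume a: "a \<in> (\<lambda>U. g * U * h) ` S"
    then obtain U where U: "U \<in> S" "a = g * U * h" by blast
    show "k \<cdot>\<^sub>m a \<in> (\<lambda>U. g * U * h) ` S" for k
      unfolding U(2) 2[OF U(1)] using U(1) S unfolding csubspace_gl_def by blast
    fix b assume b: "b \<in> (\<lambda>U. g * U * h) ` S"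
    then obtain V where V: "V \<in> S" "b = g * V * h" by blast
    show "a + b \<in> (\<lambda>U. g * U * h) ` S"
      unfolding U(2) V(2) 1[OF U(1) V(1)] using U(1) V(1) S unfolding csubspace_gl_def by blast
  qed
qed

lemma conj_by_lie_bracket:
  assumes gh: "inv_pair N g h" and a: "a \<in> conj_by g h (tri_mats N k)" and b: "b \<in> conj_by g h (tri_mats N k)"
  shows "lie_bracket a b \<in> conj_by g h (tri_mats N (Suc k))"
proof -
  obtain U V where UV: "U \<in> tri_mats N k" "V \<in> tri_mats N k" "a = g * U * h" "b = g * V * h"
    using a b by (auto simp: conj_by_def)
  then have "U \<in> carrier_mat N N" "V \<in> carrier_mat N N" by (auto simp: tri_mats_def)
  then have "lie_bracket a b = g * lie_bracket U V * h"
    unfolding UV(3,4) using lie_bracket_conj[OF inv_pair_sym[OF gh]] by simp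
  then show ?thesis unfolding conj_by_def using tri_mats_lie_bracket[OF UV(1,2)] by blast
qed

lemma lie_subalgebra_conj_by:
  assumes gh: "inv_pair N g h"
  shows "lie_subalgebra N (conj_by g h (tri_mats N 0))"
  unfolding lie_subalgebra_def
  using csubspace_conj_by[OF gh csubspace_tri_mats] conj_by_lie_bracket[OF gh, of _ 0] tri_mats_mono[of 0 1 N]
  by (fastforce simp: conj_by_def)

lemma cspan_gl_least: "csubspace_gl N V \<Longrightarrow> S \<subseteq> V \<Longrightarrow> cspan_gl N S \<subseteq> V"
  by (auto simp: cspan_gl_def)

lemma cspan_gl_superset: "S \<subseteq> cspan_gl N S"
  by (auto simp: cspan_gl_def)

lemma csubspace_cspan_gl:
  assumes "S \<subseteq> carrier_mat N N"
  shows "csubspace_gl N (cspan_gl N S)"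
proof -
  have "csubspace_gl N (carrier_mat N N)" by (auto simp: csubspace_gl_def)
  then have "cspan_gl N S \<subseteq> carrier_mat N N" using assms by (rule cspan_gl_least)
  then show ?thesis unfolding csubspace_gl_def cspan_gl_def by blast
qed

text \<open>The span \<open>C\<close> of the brackets of \<open>D\<close> lies in \<open>D\<close>,
  so brackets of elements of \<open>C\<close> are already generators of \<open>C\<close>.\<close>

lemma lie_subalgebra_derived:
  assumes "lie_subalgebra N B"
  shows "lie_subalgebra N (derived N B k) \<and> derived N B (Suc k) \<subseteq> derived N B k"
proof -
  have step: "lie_subalgebra N C \<and> C \<subseteq> D"
    if D: "lie_subalgebra N D" and C: "C = cspan_gl N {lie_bracket a b | a b. a \<in> D \<and> b \<in> D}" for D C
  proof
    have 1: "{lie_bracket a b | a b. a \<in> D \<and> b \<in> D} \<subseteq> D" using D by (auto simp: lie_subalgebra_def)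
    then show 2: "C \<subseteq> D"
      using D unfolding C by (intro cspan_gl_least) (auto simp: lie_subalgebra_def)
    have "D \<subseteq> carrier_mat N N" using D by (auto simp: lie_subalgebra_def csubspace_gl_def)
    then have "csubspace_gl N C" unfolding C using 1 by (intro csubspace_cspan_gl) (rule subset_trans)
    moreover have "lie_bracket a b \<in> C" if "a \<in> C" "b \<in> C" for a b
    proof -
      have "a \<in> D" "b \<in> D" using that 2 by auto
      then show ?thesis unfolding C by (intro subsetD[OF cspan_gl_superset]) auto
    qed
    ultimately show "lie_subalgebra N C" unfolding lie_subalgebra_def by blast
  qed
  have "lie_subalgebra N (derived N B k)" by (induction k) (use assms step in auto)
  then show ?thesis using step by simp
qed

lemma solvable_conj_by:
  assumes gh: "inv_pair N g h"
  shows "solvable_lie N (conj_by g h (tri_mats N 0))"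
proof -
  let ?T = "conj_by g h (tri_mats N 0)"
  have "derived N ?T k \<subseteq> conj_by g h (tri_mats N k)" for k
  proof (induction k)
    case (Suc k)
    then show ?case unfolding derived.simps
      using conj_by_lie_bracket[OF gh] by (intro cspan_gl_least csubspace_conj_by[OF gh csubspace_tri_mats]) blast
  qed simp
  moreover have "conj_by g h (tri_mats N N) \<subseteq> {0\<^sub>m N N}"
  proof -
    have "U = 0\<^sub>m N N" if "U \<in> tri_mats N N" for U
      using that by (intro eq_matI) (auto simp: tri_mats_def)
    moreover have "g * 0\<^sub>m N N * h = 0\<^sub>m N N" using inv_pair_carrier[OF gh] by simp
    ultimately show ?thesis unfolding conj_by_def by (metis image_subsetI insertI1)
  qed
  \<comment> \<open>Solvability asks for equality with the zero space, so zero must also be shown to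
    belong.\<close>
  moreover have "0\<^sub>m N N \<in> derived N ?T N"
    using lie_subalgebra_derived[OF lie_subalgebra_conj_by[OF gh]] by (auto simp: lie_subalgebra_def csubspace_gl_def)
  ultimately show ?thesis unfolding solvable_lie_def by (intro exI[of _ N]) blast
qed

lemma solvable_imp_solvable_chain:
  assumes B: "lie_subalgebra N B" and "solvable_lie N B"
  shows "\<exists>k. solvable_chain N k B"
proof -
  obtain K where K: "derived N B K = {0\<^sub>m N N}" using assms by (auto simp: solvable_lie_def)
  \<comment> \<open>\<open>solvable_chain\<close> counts the steps still to go, the derived series
    those already taken; hence the index \<open>K - j\<close>.\<close>
  have "j \<le> K \<Longrightarrow> solvable_chain N j (derived N B (K - j))" for j
  proof (induction j)
    case 0
    then show ?case using K by simp
  next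
    case (Suc j)
    define i where "i = K - Suc j"
    have i: "K - j = Suc i" using Suc.prems by (simp add: i_def)
    have "lie_bracket a b \<in> derived N B (Suc i)" if "a \<in> derived N B i" "b \<in> derived N B i" for a b
      using cspan_gl_superset that by (fastforce simp only: derived.simps)
    moreover have "solvable_chain N j (derived N B (Suc i))" using Suc i by simp
    moreover have "derived N B i \<subseteq> carrier_mat N N" "derived N B (Suc i) \<subseteq> derived N B i"
      using lie_subalgebra_derived[OF B, of i] by (auto simp only: lie_subalgebra_def csubspace_gl_def)
    ultimately show ?case unfolding i_def[symmetric] solvable_chain.simps by blast
  qed
  from this[of K] show ?thesis by auto
qed

text \<open>Lie's theorem gives only an inclusion in a conjugate of the upper triangular matrices.
  That conjugate is itself a solvable subalgebra, so maximality turns the inclusion into an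
  equality.\<close>

theorem borel_subalgebra_conj_tri:
  assumes b: "borel_subalgebra N b"
  shows "\<exists>g h. inv_pair N g h \<and> b = conj_by g h (tri_mats N 0)"
proof -
  have lie: "lie_subalgebra N b" and "solvable_lie N b" using b by (auto simp: borel_subalgebra_def)
  then obtain g h where gh: "inv_pair N g h" and ut: "\<And>x. x \<in> b \<Longrightarrow> upper_triangular (h * x * g)"
    using solvable_imp_solvable_chain solvable_chain_triangularizable by metis
  note c = inv_pair_carrier[OF gh]
  have "b \<subseteq> conj_by g h (tri_mats N 0)"
  proof
    fix x assume x: "x \<in> b"
    then have xc: "x \<in> carrier_mat N N" using lie by (auto simp: lie_subalgebra_def csubspace_gl_def)
    have "h * x * g \<in> carrier_mat N N" using c xc by simp
    then have "h * x * g \<in> tri_mats N 0" using upper_triangularD[OF ut[OF x]] unfolding tri_mats_def by auto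
    moreover have "g * (h * x * g) * h = x"
    proof -
      have "g * (h * x * g) = x * g"
        using inv_pair_cancel(1)[OF gh, of "x * g" N] assoc_mult_mat[OF c(2) xc c(1)] c xc by simp
      then have "g * (h * x * g) * h = x * (g * h)" using assoc_mult_mat[OF xc c] by simp
      also have "\<dots> = x" using gh xc by (simp add: inv_pair_def)
      finally show ?thesis .
    qed
    ultimately show "x \<in> conj_by g h (tri_mats N 0)" unfolding conj_by_def by (metis imageI)
  qed
  then show ?thesis using b gh lie_subalgebra_conj_by[OF gh] solvable_conj_by[OF gh] unfolding borel_subalgebra_def by metis
qed

section \<open>Linear independence along polynomial curves\<close>

text \<open>Independence of vectors indexed by \<open>J\<close> with coordinates in
  \<open>W\<close>. The family is indexed, so a repeated vector counts as a dependence.\<close>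

definition indep_fam :: "'j set \<Rightarrow> 'w set \<Rightarrow> ('j \<Rightarrow> 'w \<Rightarrow> complex) \<Rightarrow> bool" where
  "indep_fam J W f \<longleftrightarrow> (\<forall>c. (\<forall>w\<in>W. (\<Sum>j\<in>J. c j * f j w) = 0) \<longrightarrow> (\<forall>j\<in>J. c j = 0))"

lemma indep_famD:
  "indep_fam J W f \<Longrightarrow> (\<And>w. w \<in> W \<Longrightarrow> (\<Sum>j\<in>J. c j * f j w) = 0) \<Longrightarrow> j \<in> J \<Longrightarrow> c j = 0"
  unfolding indep_fam_def by blast

definition is_poly :: "(complex \<Rightarrow> complex) \<Rightarrow> bool" where
  "is_poly f \<longleftrightarrow> (\<exists>p. \<forall>t. f t = poly p t)"

lemma is_poly_const[simp]: "is_poly (\<lambda>t. c)"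
  unfolding is_poly_def by (rule exI[of _ "[:c:]"]) simp

lemma is_poly_id[simp]: "is_poly (\<lambda>t. t)"
  unfolding is_poly_def by (rule exI[of _ "[:0,1:]"]) simp

lemma is_poly_add: "is_poly f \<Longrightarrow> is_poly g \<Longrightarrow> is_poly (\<lambda>t. f t + g t)"
  unfolding is_poly_def by (metis poly_add)

lemma is_poly_mult: "is_poly f \<Longrightarrow> is_poly g \<Longrightarrow> is_poly (\<lambda>t. f t * g t)"
  unfolding is_poly_def by (metis poly_mult)

lemma is_poly_sum: "(\<And>i. i \<in> A \<Longrightarrow> is_poly (f i)) \<Longrightarrow> is_poly (\<lambda>t. \<Sum>i\<in>A. f i t)"
  by (induction A rule: infinite_finite_induct) (auto intro!: is_poly_add)

lemma is_poly_prod: "(\<And>i. i \<in> A \<Longrightarrow> is_poly (f i)) \<Longrightarrow> is_poly (\<lambda>t. \<Prod>i\<in>A. f i t)"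
  by (induction A rule: infinite_finite_induct) (auto intro!: is_poly_mult)

lemma is_poly_finite_zeros:
  assumes "is_poly f" "f t0 \<noteq> 0"
  shows "finite {t. f t = 0}"
proof -
  obtain p where p: "\<And>t. f t = poly p t" using assms by (auto simp: is_poly_def)
  then have "p \<noteq> 0" using assms(2) by auto
  then show ?thesis using poly_roots_finite p by simp
qed

lemma is_poly_det:
  assumes "\<And>i j. i < n \<Longrightarrow> j < n \<Longrightarrow> is_poly (\<lambda>t. f t i j)"
  shows "is_poly (\<lambda>t. Determinant.det (mat n n (\<lambda>(i,j). f t i j)))"
proof -
  have "Determinant.det (mat n n (\<lambda>(i,j). f t i j))
      = (\<Sum>p\<in>{p. p permutes {0..<n}}. signof p * (\<Prod>i = 0..<n. f t i (p i)))" for t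
    using permutes_in_image by (subst det_def'[of _ n]) (fastforce intro!: sum.cong prod.cong arg_cong2[of _ _ _ _ "(*)"])+
  moreover have "is_poly (\<lambda>t. \<Sum>p\<in>{p. p permutes {0..<n}}. signof p * (\<Prod>i = 0..<n. f t i (p i)))"
    by (intro is_poly_sum is_poly_mult is_poly_const is_poly_prod assms) (use permutes_in_image in fastforce)+
  ultimately show ?thesis by simp
qed

text \<open>Pairing with the conjugated family at \<open>t0\<close> turns independence at \<open>t\<close> into the nonvanishing of a determinant that is polynomial in \<open>t\<close> and, at \<open>t0\<close>, a Gram determinant.\<close>

lemma indep_fam_cofinite:
  fixes F :: "complex \<Rightarrow> 'j \<Rightarrow> 'w \<Rightarrow> complex"
  assumes J: "finite J" and W: "finite W" 
    and poly: "\<And>j w. j \<in> J \<Longrightarrow> w \<in> W \<Longrightarrow> is_poly (\<lambda>t. F t j w)"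
    and indep: "indep_fam J W (F t0)"
  shows "finite {t. \<not> indep_fam J W (F t)}"
proof -
  obtain e where e: "bij_betw e {0..<card J} J" using ex_bij_betw_nat_finite[OF J] by blast
  define d where "d = card J"
  have e: "bij_betw e {0..<d} J" using e by (simp add: d_def)
  define G where "G t i j = (\<Sum>w\<in>W. cnj (F t0 (e i) w) * F t (e j) w)" for t i j
  have eJ: "e i \<in> J" if "i < d" for i using e that by (auto simp: bij_betw_def)
  have isp: "is_poly (\<lambda>t. Determinant.det (mat d d (\<lambda>(i,j). G t i j)))"
    unfolding G_def by (intro is_poly_det is_poly_sum is_poly_mult is_poly_const poly eJ)
  have dep: "Determinant.det (mat d d (\<lambda>(i,j). G t i j)) = 0" if nindep: "\<not> indep_fam J W (F t)" for t
  proof -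
    obtain c j0 where c: "\<And>w. w \<in> W \<Longrightarrow> (\<Sum>j\<in>J. c j * F t j w) = 0" "j0 \<in> J" "c j0 \<noteq> 0"
      using nindep unfolding indep_fam_def by blast
    define v where "v = vec d (\<lambda>i. c (e i))"
    have "v \<in> carrier_vec d" by (simp add: v_def)
    moreover obtain i0 where i0: "i0 < d" "e i0 = j0" using e c(2) by (auto simp: bij_betw_def)
    then have "v $ i0 \<noteq> 0" using c(3) by (simp add: v_def)
    then have "v \<noteq> 0\<^sub>v d" using i0 by auto
    moreover have "mat d d (\<lambda>(i,j). G t i j) *\<^sub>v v = 0\<^sub>v d"
    proof (rule eq_vecI)
      fix i assume "i < dim_vec (0\<^sub>v d :: complex vec)"
      then have i: "i < d" by simp
      have "(mat d d (\<lambda>(i,j). G t i j) *\<^sub>v v) $ i = (\<Sum>k=0..<d. \<Sum>w\<in>W. cnj (F t0 (e i) w) * (c (e k) * F t (e k) w))"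
        using i by (simp add: scalar_prod_def v_def G_def sum_distrib_right sum_distrib_left mult_ac)
      also have "\<dots> = (\<Sum>w\<in>W. cnj (F t0 (e i) w) * (\<Sum>k=0..<d. c (e k) * F t (e k) w))"
        by (subst sum.swap) (simp add: sum_distrib_left)
      also have "\<dots> = (\<Sum>w\<in>W. cnj (F t0 (e i) w) * (\<Sum>j\<in>J. c j * F t j w))"
        by (simp add: sum.reindex_bij_betw[OF e, of "\<lambda>j. c j * F t j _"])
      also have "\<dots> = 0" using c(1) by simp
      finally show "(mat d d (\<lambda>(i,j). G t i j) *\<^sub>v v) $ i = 0\<^sub>v d $ i" using i by simp
    qed simp
    ultimately show ?thesis using det_0_iff_vec_prod_zero_field[of "mat d d (\<lambda>(i,j). G t i j)" d] by auto
  qed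
  have "Determinant.det (mat d d (\<lambda>(i,j). G t0 i j)) \<noteq> 0"
  proof
    assume "Determinant.det (mat d d (\<lambda>(i,j). G t0 i j)) = 0"
    then obtain v where v: "v \<in> carrier_vec d" "v \<noteq> 0\<^sub>v d" "mat d d (\<lambda>(i,j). G t0 i j) *\<^sub>v v = 0\<^sub>v d"
      using det_0_iff_vec_prod_zero_field[of "mat d d (\<lambda>(i,j). G t0 i j)" d] by auto
    define s where "s w = (\<Sum>k=0..<d. v $ k * F t0 (e k) w)" for w
    have row: "(\<Sum>w\<in>W. cnj (F t0 (e i) w) * s w) = 0" if i: "i < d" for i
    proof -
      have "0 = (mat d d (\<lambda>(i,j). G t0 i j) *\<^sub>v v) $ i" using v i by simp
      also have "\<dots> = (\<Sum>k=0..<d. \<Sum>w\<in>W. cnj (F t0 (e i) w) * (v $ k * F t0 (e k) w))"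
        using i v(1) by (simp add: scalar_prod_def G_def sum_distrib_right sum_distrib_left mult_ac)
      also have "\<dots> = (\<Sum>w\<in>W. cnj (F t0 (e i) w) * s w)"
        by (subst sum.swap) (simp add: sum_distrib_left s_def)
      finally show ?thesis by simp
    qed
    \<comment> \<open>The quadratic form of the Gram matrix at \<open>v\<close> is the squared norm
      of the combination \<open>s\<close>, so a kernel vector makes \<open>s\<close> vanish.\<close>
    have "(\<Sum>w\<in>W. of_real ((cmod (s w))\<^sup>2)) = (\<Sum>w\<in>W. \<Sum>i=0..<d. cnj (v $ i) * (cnj (F t0 (e i) w) * s w))"
      by (intro sum.cong refl, subst complex_norm_square)
         (simp add: s_def[of "_"] sum_distrib_right sum_distrib_left mult_ac)
    also have "\<dots> = (\<Sum>i=0..<d. cnj (v $ i) * (\<Sum>w\<in>W. cnj (F t0 (e i) w) * s w))"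
      by (subst sum.swap) (simp add: sum_distrib_left)
    also have "\<dots> = 0" using row by simp
    finally have "complex_of_real (\<Sum>w\<in>W. (cmod (s w))\<^sup>2) = 0" by simp
    then have "(\<Sum>w\<in>W. (cmod (s w))\<^sup>2) = 0" by (simp only: of_real_eq_0_iff)
    then have s0: "s w = 0" if "w \<in> W" for w
      using sum_nonneg_eq_0_iff[OF W, of "\<lambda>w. (cmod (s w))\<^sup>2"] that by simp
    define c where "c j = v $ (the_inv_into {0..<d} e j)" for j
    have ce: "c (e k) = v $ k" if "k < d" for k
      using the_inv_into_f_f[of e "{0..<d}" k] e that by (simp add: c_def bij_betw_def)
    have "(\<Sum>j\<in>J. c j * F t0 j w) = 0" if "w \<in> W" for w
      using s0[OF that] unfolding s_def sum.reindex_bij_betw[OF e, of "\<lambda>j. c j * F t0 j w", symmetric]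
      by (simp add: ce)
    then have "\<forall>j\<in>J. c j = 0" using indep unfolding indep_fam_def by blast
    then have "v $ k = 0" if "k < d" for k using ce[OF that] eJ[OF that] by simp
    then have "v = 0\<^sub>v d" using v(1) by (intro eq_vecI) auto
    then show False using v(2) by simp
  qed
  then have "finite {t. Determinant.det (mat d d (\<lambda>(i,j). G t i j)) = 0}" using is_poly_finite_zeros[OF isp] by blast
  then show ?thesis by (rule rev_finite_subset) (use dep in blast)
qed

section \<open>Strong regularity as linear independence of powers\<close>

lemma pow_mat_add:
  assumes "A \<in> carrier_mat n n"
  shows "A ^\<^sub>m (k + l) = A ^\<^sub>m k * A ^\<^sub>m l"
proof (induction l)
  case 0
  then show ?case using assms by simp
next
  case (Suc l)
  then show ?case using assms assoc_mult_mat[of "A ^\<^sub>m k" n n "A ^\<^sub>m l" n A n] by simp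
qed

text \<open>\<open>B\<close> need not commute with \<open>A\<close>, so only traces of the
  derivative \<open>D\<close> have a closed form. The extra factor \<open>A ^\<^sub>m s\<close> lets
  the induction pass: the product rule puts one more \<open>A\<close> behind \<open>D\<close>, and
  cyclicity of the trace collects the powers in front of \<open>B\<close>.\<close>

lemma pow_mat_deriv:
  fixes A B :: "complex mat"
  assumes A: "A \<in> carrier_mat n n" and B: "B \<in> carrier_mat n n"
  shows "\<exists>D\<in>carrier_mat n n. 
    (\<forall>i<n. \<forall>j<n. ((\<lambda>t. ((A + t \<cdot>\<^sub>m B) ^\<^sub>m k) $$ (i,j)) has_field_derivative D $$ (i,j)) (at 0)) \<and>
    (\<forall>s. mtrace (D * A ^\<^sub>m s) = of_nat k * mtrace (A ^\<^sub>m (k - 1 + s) * B))"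
proof (induction k)
  case 0
  have "mtrace (0\<^sub>m n n * A ^\<^sub>m s) = 0" for s using A by (simp add: mtrace_def)
  then show ?case by (intro bexI[of _ "0\<^sub>m n n"]) (use A in auto)
next
  case (Suc k)
  obtain D where D: "D \<in> carrier_mat n n"
    "\<And>i j. i < n \<Longrightarrow> j < n \<Longrightarrow> ((\<lambda>t. ((A + t \<cdot>\<^sub>m B) ^\<^sub>m k) $$ (i,j)) has_field_derivative D $$ (i,j)) (at 0)"
    "\<And>s. mtrace (D * A ^\<^sub>m s) = of_nat k * mtrace (A ^\<^sub>m (k - 1 + s) * B)"
    using Suc by blast
  have At: "A + t \<cdot>\<^sub>m B \<in> carrier_mat n n" for t using A B by simp
  have A0: "A + 0 \<cdot>\<^sub>m B = A" using A B by (intro eq_matI) auto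
  have Ak: "A ^\<^sub>m k \<in> carrier_mat n n" for k using A by simp
  define D' where "D' = D * A + A ^\<^sub>m k * B"
  have D': "D' \<in> carrier_mat n n" unfolding D'_def by (rule add_carrier_mat[OF mult_carrier_mat[OF Ak B]])
  have der: "((\<lambda>t. ((A + t \<cdot>\<^sub>m B) ^\<^sub>m Suc k) $$ (i,j)) has_field_derivative D' $$ (i,j)) (at 0)" if ij: "i < n" "j < n" for i j
  proof -
    have e: "((A + t \<cdot>\<^sub>m B) ^\<^sub>m Suc k) $$ (i,j) = (\<Sum>l<n. ((A + t \<cdot>\<^sub>m B) ^\<^sub>m k) $$ (i,l) * (A $$ (l,j) + t * B $$ (l,j)))" for t
      using index_mult_mat_sum[OF pow_carrier_mat[of "A + t \<cdot>\<^sub>m B" n k, OF At] At ij] A B ij by simp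
    have "D' $$ (i,j) = (\<Sum>l<n. D $$ (i,l) * A $$ (l,j) + (A ^\<^sub>m k) $$ (i,l) * B $$ (l,j))"
      unfolding D'_def using index_mult_mat_sum[OF D(1) A ij] index_mult_mat_sum[OF Ak B ij] A B D ij
      by (simp add: sum.distrib del: index_mult_mat(1))
    moreover have "((\<lambda>t. (\<Sum>l<n. ((A + t \<cdot>\<^sub>m B) ^\<^sub>m k) $$ (i,l) * (A $$ (l,j) + t * B $$ (l,j)))) has_field_derivative 
      (\<Sum>l<n. D $$ (i,l) * A $$ (l,j) + (A ^\<^sub>m k) $$ (i,l) * B $$ (l,j))) (at 0)"
    proof (rule DERIV_sum)
      fix l assume l: "l \<in> {..<n}"
      have "((\<lambda>t. A $$ (l,j) + t * B $$ (l,j)) has_field_derivative B $$ (l,j)) (at 0)"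
        by (auto intro!: derivative_eq_intros)
      from DERIV_mult[OF D(2)[OF ij(1)] this, of l] l
      show "((\<lambda>t. ((A + t \<cdot>\<^sub>m B) ^\<^sub>m k) $$ (i,l) * (A $$ (l,j) + t * B $$ (l,j))) has_field_derivative 
        D $$ (i,l) * A $$ (l,j) + (A ^\<^sub>m k) $$ (i,l) * B $$ (l,j)) (at 0)"
        by (simp add: A0 mult.commute del: index_mult_mat)
    qed
    ultimately show ?thesis by (simp only: e)
  qed
  have tr: "mtrace (D' * A ^\<^sub>m s) = of_nat (Suc k) * mtrace (A ^\<^sub>m (Suc k - 1 + s) * B)" for s
  proof -
    have "A * A ^\<^sub>m s = A ^\<^sub>m Suc s" using pow_mat_add[OF A, of 1 s] A by simp
    then have "D * A * A ^\<^sub>m s = D * A ^\<^sub>m Suc s" using assoc_mult_mat[OF D(1) A Ak] by metis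
    then have "D' * A ^\<^sub>m s = D * A ^\<^sub>m Suc s + A ^\<^sub>m k * B * A ^\<^sub>m s"
      unfolding D'_def using add_mult_distrib_mat[OF mult_carrier_mat[OF D(1) A] mult_carrier_mat[OF Ak B] Ak] by metis
    moreover have "mtrace (A ^\<^sub>m k * B * A ^\<^sub>m s) = mtrace (A ^\<^sub>m (k + s) * B)"
    proof -
      have "mtrace (A ^\<^sub>m k * B * A ^\<^sub>m s) = mtrace (A ^\<^sub>m s * (A ^\<^sub>m k * B))"
        using A B Ak by (intro mtrace_comm[of _ n n]) auto
      also have "A ^\<^sub>m s * (A ^\<^sub>m k * B) = A ^\<^sub>m (k + s) * B"
        using assoc_mult_mat[OF Ak Ak B, of s k] pow_mat_add[OF A, of s k] by (simp add: add.commute)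
      finally show ?thesis .
    qed
    \<comment> \<open>For \<open>k = 0\<close> the factor \<open>of_nat k\<close> hides the
      truncated subtraction \<open>k - 1\<close>.\<close>
    moreover have "mtrace (D * A ^\<^sub>m Suc s) = of_nat k * mtrace (A ^\<^sub>m (k + s) * B)"
      unfolding D(3) by (cases k) auto
    moreover have "mtrace (X + Y) = mtrace X + mtrace Y" if "X \<in> carrier_mat n n" "Y \<in> carrier_mat n n" for X Y
      using that by (simp add: mtrace_def sum.distrib)
    moreover have "D * A ^\<^sub>m Suc s \<in> carrier_mat n n" "A ^\<^sub>m k * B * A ^\<^sub>m s \<in> carrier_mat n n"
      using D(1) Ak B by (auto simp del: pow_mat.simps intro!: mult_carrier_mat[of _ n n])
    ultimately have "mtrace (D' * A ^\<^sub>m s) = of_nat k * mtrace (A ^\<^sub>m (k + s) * B) + mtrace (A ^\<^sub>m (k + s) * B)"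
      by metis
    then show ?thesis by (simp add: algebra_simps)
  qed
  show ?case using D' der tr by blast
qed

lemma lead_sub_carrier[simp]: "lead_sub x i \<in> carrier_mat i i"
  by (simp add: lead_sub_def)

lemma lead_sub_line:
  assumes "x \<in> carrier_mat N N" "y \<in> carrier_mat N N" "i \<le> N"
  shows "lead_sub (x + t \<cdot>\<^sub>m y) i = lead_sub x i + t \<cdot>\<^sub>m lead_sub y i"
  using assms by (intro eq_matI) (auto simp: lead_sub_def)

lemma df_ij_eq:
  assumes x: "x \<in> carrier_mat N N" and y: "y \<in> carrier_mat N N" and i: "i \<le> N"
  shows "df_ij i j x y = of_nat j * mtrace (lead_sub x i ^\<^sub>m (j - 1) * lead_sub y i)"
proof -
  obtain D where D: "D \<in> carrier_mat i i"
    "\<And>a b. a < i \<Longrightarrow> b < i \<Longrightarrow> ((\<lambda>t. ((lead_sub x i + t \<cdot>\<^sub>m lead_sub y i) ^\<^sub>m j) $$ (a,b)) has_field_derivative D $$ (a,b)) (at 0)"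
    "\<And>s. mtrace (D * lead_sub x i ^\<^sub>m s) = of_nat j * mtrace (lead_sub x i ^\<^sub>m (j - 1 + s) * lead_sub y i)"
    using pow_mat_deriv[OF lead_sub_carrier[of x i] lead_sub_carrier[of y i], of j] by blast
  have f_eq: "f_ij i j (x + t \<cdot>\<^sub>m y) = (\<Sum>a<i. ((lead_sub x i + t \<cdot>\<^sub>m lead_sub y i) ^\<^sub>m j) $$ (a,a))" for t
  proof -
    have c: "(lead_sub x i + t \<cdot>\<^sub>m lead_sub y i) ^\<^sub>m j \<in> carrier_mat i i" by (intro pow_carrier_mat) simp
    show ?thesis unfolding f_ij_def lead_sub_line[OF x y i] mtrace_def carrier_matD(1)[OF c] ..
  qed
  have "((\<lambda>t. f_ij i j (x + t \<cdot>\<^sub>m y)) has_field_derivative (\<Sum>a<i. D $$ (a,a))) (at 0)"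
    unfolding f_eq by (rule DERIV_sum, rule D(2)) auto
  then have "df_ij i j x y = (\<Sum>a<i. D $$ (a,a))"
    unfolding df_ij_def by (rule DERIV_imp_deriv)
  also have "\<dots> = mtrace D" using D(1) by (simp add: mtrace_def)
  also have "mtrace D = mtrace (D * lead_sub x i ^\<^sub>m 0)" using D(1) by (simp add: lead_sub_def)
  finally show ?thesis unfolding D(3) by simp
qed

text \<open>The exponent \<open>snd p - 1\<close> comes from differentiating the trace of a power.
  In \<open>GZ_index\<close> second components start at 1, so the subtraction is never
  truncated.\<close>

definition gz_entry :: "complex mat \<Rightarrow> nat \<times> nat \<Rightarrow> nat \<times> nat \<Rightarrow> complex" where
  "gz_entry x p w = (if fst w < fst p \<and> snd w < fst p then (lead_sub x (fst p) ^\<^sub>m (snd p - 1)) $$ w else 0)"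

definition gz_indep :: "nat \<Rightarrow> complex mat \<Rightarrow> bool" where
  "gz_indep N x \<longleftrightarrow> indep_fam (GZ_index N) ({..<N} \<times> {..<N}) (gz_entry x)"

lemma finite_GZ_index[simp]: "finite (GZ_index N)"
  by (rule finite_subset[of _ "{..N} \<times> {..N}"]) (auto simp: GZ_index_def)

text \<open>Differentials tested on elementary matrices give the entries of the padded powers up to
  the factor \<open>snd p\<close>. That factor goes into the coefficients and is nonzero on
  \<open>GZ_index\<close>.\<close>

lemma gz_indep_imp_strongly_regular:
  assumes x: "x \<in> carrier_mat N N" and indep: "gz_indep N x"
  shows "strongly_regular N x"
  unfolding strongly_regular_def
proof (intro conjI allI impI x)
  fix c :: "nat \<times> nat \<Rightarrow> complex"
  assume c: "\<forall>y\<in>carrier_mat N N. (\<Sum>p\<in>GZ_index N. c p * df_ij (fst p) (snd p) x y) = 0"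
  have "(\<Sum>p\<in>GZ_index N. (c p * of_nat (snd p)) * gz_entry x p w) = 0" if w: "w \<in> {..<N} \<times> {..<N}" for w
  proof -
    obtain a b where ab: "w = (a,b)" "a < N" "b < N" using w by auto
    \<comment> \<open>The 1 sits at the transposed place \<open>(b,a)\<close>, so that the trace
      against \<open>X\<close> picks out \<open>X $$ (a,b)\<close>.\<close>
    define y where "y = (mat N N (\<lambda>(r,s). if r = b \<and> s = a then 1 else 0) :: complex mat)"
    have y: "y \<in> carrier_mat N N" by (simp add: y_def)
    have "mtrace (X * lead_sub y i) = (if a < i \<and> b < i then X $$ (a,b) else 0)" if X: "X \<in> carrier_mat i i" and i: "i \<le> N" for X i
    proof -
      have "mtrace (X * lead_sub y i) = (\<Sum>r<i. \<Sum>s<i. X $$ (r,s) * lead_sub y i $$ (s,r))"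
        unfolding mtrace_def using X by (simp add: index_mult_mat_sum[OF X lead_sub_carrier] del: index_mult_mat(1))
      also have "\<dots> = (\<Sum>r<i. \<Sum>s<i. if s = b then (if r = a then X $$ (a,b) else 0) else 0)"
        using i by (intro sum.cong refl) (auto simp: lead_sub_def y_def)
      also have "\<dots> = (if a < i \<and> b < i then X $$ (a,b) else 0)"
        by (cases "b < i") (simp_all add: sum.delta)
      finally show ?thesis .
    qed
    then have "df_ij (fst p) (snd p) x y = of_nat (snd p) * gz_entry x p w" if "p \<in> GZ_index N" for p
      using df_ij_eq[OF x y, of "fst p" "snd p"] that ab by (auto simp: gz_entry_def GZ_index_def)
    then have "(\<Sum>p\<in>GZ_index N. (c p * of_nat (snd p)) * gz_entry x p w) = (\<Sum>p\<in>GZ_index N. c p * df_ij (fst p) (snd p) x y)"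
      by (intro sum.cong) auto
    then show ?thesis using c y by simp
  qed
  then have "c p * of_nat (snd p) = 0" if "p \<in> GZ_index N" for p
    by (rule indep_famD[OF indep[unfolded gz_indep_def], where c = "\<lambda>p. c p * of_nat (snd p)"]) (use that in blast)+
  then show "\<forall>p\<in>GZ_index N. c p = 0" by (auto simp: GZ_index_def)
qed

text \<open>\<open>True\<close> reads the last column and \<open>False\<close> the last row;
  together they give one coordinate vector for the border of a power.\<close>

definition corner_entry :: "nat \<Rightarrow> complex mat \<Rightarrow> nat \<Rightarrow> bool \<times> nat \<Rightarrow> complex" where
  "corner_entry M x k w = (if fst w then (x ^\<^sub>m k) $$ (snd w, M) else (x ^\<^sub>m k) $$ (M, snd w))"

definition corner_indep :: "nat \<Rightarrow> complex mat \<Rightarrow> bool" where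
  "corner_indep M x \<longleftrightarrow> indep_fam {..M} (UNIV \<times> {..M}) (corner_entry M x)"

lemma GZ_index_Suc: "GZ_index (Suc M) = GZ_index M \<union> (\<lambda>k. (Suc M, Suc k)) ` {..M}"
proof (intro equalityI subsetI)
  fix p assume "p \<in> GZ_index (Suc M)"
  then obtain i j where p: "p = (i,j)" "1 \<le> j" "j \<le> i" "i \<le> Suc M" by (auto simp: GZ_index_def)
  then show "p \<in> GZ_index M \<union> (\<lambda>k. (Suc M, Suc k)) ` {..M}"
    by (cases "i = Suc M"; cases j) (auto simp: GZ_index_def)
qed (auto simp: GZ_index_def)

lemma gz_indep_Suc:
  assumes x: "x \<in> carrier_mat (Suc M) (Suc M)" and gz: "gz_indep M x" and corner: "corner_indep M x"
  shows "gz_indep (Suc M) x"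
  unfolding gz_indep_def indep_fam_def
proof (intro allI impI)
  fix c :: "nat \<times> nat \<Rightarrow> complex"
  assume c: "\<forall>w\<in>{..<Suc M} \<times> {..<Suc M}. (\<Sum>p\<in>GZ_index (Suc M). c p * gz_entry x p w) = 0"
  have xl: "lead_sub x (Suc M) = x" using x by (intro eq_matI) (auto simp: lead_sub_def)
  have split: "(\<Sum>p\<in>GZ_index M. c p * gz_entry x p (a,b)) + (\<Sum>k\<le>M. c (Suc M, Suc k) * (x ^\<^sub>m k) $$ (a,b)) = 0"
    if ab: "a \<le> M" "b \<le> M" for a b
  proof -
    have inj: "inj_on (\<lambda>k. (Suc M, Suc k)) {..M}" by (auto simp: inj_on_def)
    have "0 = (\<Sum>p\<in>GZ_index (Suc M). c p * gz_entry x p (a,b))" using c ab by auto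
    also have "\<dots> = (\<Sum>p\<in>GZ_index M. c p * gz_entry x p (a,b)) + (\<Sum>p\<in>(\<lambda>k. (Suc M, Suc k)) ` {..M}. c p * gz_entry x p (a,b))"
      unfolding GZ_index_Suc by (subst sum.union_disjoint) (simp_all, auto simp: GZ_index_def)
    also have "(\<Sum>p\<in>(\<lambda>k. (Suc M, Suc k)) ` {..M}. c p * gz_entry x p (a,b)) = (\<Sum>k\<le>M. c (Suc M, Suc k) * (x ^\<^sub>m k) $$ (a,b))"
      unfolding sum.reindex[OF inj] o_def using ab by (simp add: gz_entry_def xl)
    finally show ?thesis by simp
  qed
  \<comment> \<open>Smaller corners do not reach index \<open>M\<close>, so on the border only the
    powers of the full matrix \<open>x\<close> contribute to the relation.\<close>
  have zero: "gz_entry x p (a,b) = 0" if "p \<in> GZ_index M" "a = M \<or> b = M" for p a b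
    using that by (auto simp: gz_entry_def GZ_index_def)
  have "\<forall>k\<in>{..M}. c (Suc M, Suc k) = 0"
  proof -
    have "(\<Sum>k\<in>{..M}. c (Suc M, Suc k) * corner_entry M x k w) = 0" if "w \<in> UNIV \<times> {..M}" for w
      using split[of "snd w" M] split[of M "snd w"] zero that by (cases "fst w") (auto simp: corner_entry_def mem_Times_iff)
    then show ?thesis using corner[unfolded corner_indep_def indep_fam_def, rule_format, of "\<lambda>k. c (Suc M, Suc k)"] by blast
  qed
  moreover from this have "(\<Sum>p\<in>GZ_index M. c p * gz_entry x p w) = 0" if "w \<in> {..<M} \<times> {..<M}" for w
    using split[of "fst w" "snd w"] that by (auto simp: mem_Times_iff)
  then have "\<forall>p\<in>GZ_index M. c p = 0" using gz unfolding gz_indep_def indep_fam_def by blast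
  ultimately show "\<forall>p\<in>GZ_index (Suc M). c p = 0" unfolding GZ_index_Suc by auto
qed

lemma is_poly_pow_mat:
  assumes A: "\<And>t. A t \<in> carrier_mat n n" and poly: "\<And>i j. i < n \<Longrightarrow> j < n \<Longrightarrow> is_poly (\<lambda>t. A t $$ (i,j))"
    and ij: "i < n" "j < n"
  shows "is_poly (\<lambda>t. (A t ^\<^sub>m k) $$ (i,j))"
  using ij
proof (induction k arbitrary: i j)
  case 0
  have "A t ^\<^sub>m 0 = 1\<^sub>m n" for t using A[of t] by simp
  then show ?case by simp
next
  case (Suc k)
  have "(A t ^\<^sub>m Suc k) $$ (i,j) = (\<Sum>l<n. (A t ^\<^sub>m k) $$ (i,l) * A t $$ (l,j))" for t
    using index_mult_mat_sum[OF pow_carrier_mat[OF A] A Suc.prems] by simp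
  moreover have "is_poly (\<lambda>t. \<Sum>l<n. (A t ^\<^sub>m k) $$ (i,l) * A t $$ (l,j))"
    using Suc by (intro is_poly_sum is_poly_mult poly) auto
  ultimately show ?case by simp
qed

text \<open>\<open>x0\<close> settles one condition at \<open>t = 0\<close> and \<open>x1\<close>
  the other at \<open>t = 1\<close>. Each then fails for finitely many \<open>t\<close> only, and
  there are infinitely many complex numbers.\<close>

lemma exists_gz_indep_on_line:
  assumes x0: "x0 \<in> carrier_mat (Suc M) (Suc M)" "gz_indep M x0"
    and x1: "x1 \<in> carrier_mat (Suc M) (Suc M)" "corner_indep M x1"
  shows "\<exists>t. gz_indep (Suc M) (x0 + t \<cdot>\<^sub>m (x1 - x0))"
proof -
  define X where "X t = x0 + t \<cdot>\<^sub>m (x1 - x0)" for t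
  have Xc: "X t \<in> carrier_mat (Suc M) (Suc M)" for t using x0 x1 unfolding X_def by (auto intro!: add_carrier_mat)
  have Xe: "X t $$ (i,j) = x0 $$ (i,j) + t * (x1 $$ (i,j) - x0 $$ (i,j))" if "i < Suc M" "j < Suc M" for t i j
    using that x0 x1 by (simp add: X_def)
  have Xp: "is_poly (\<lambda>t. X t $$ (i,j))" if "i < Suc M" "j < Suc M" for i j
    unfolding Xe[OF that] by (intro is_poly_add is_poly_mult is_poly_const is_poly_id)
  have Lp: "is_poly (\<lambda>t. lead_sub (X t) l $$ (i,j))" if "i < l" "j < l" "l \<le> Suc M" for i j l
    using Xp[of i j] that by (simp add: lead_sub_def)
  have X0: "X 0 = x0" using x0 x1 by (intro eq_matI) (auto simp: X_def)
  have X1: "X 1 = x1" using x0 x1 by (intro eq_matI) (auto simp: X_def)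
  have "finite {t. \<not> gz_indep M (X t)}" unfolding gz_indep_def
  proof (rule indep_fam_cofinite)
    fix p w assume p: "p \<in> GZ_index M" and "w \<in> {..<M} \<times> {..<M}"
    obtain l m a b where pw: "p = (l,m)" "w = (a,b)" by (cases p; cases w) auto
    have l: "l \<le> Suc M" using p pw by (auto simp: GZ_index_def)
    have "is_poly (\<lambda>t. (lead_sub (X t) l ^\<^sub>m (m - 1)) $$ (a,b))" if "a < l" "b < l"
      by (rule is_poly_pow_mat[where n = l]) (use that l Lp in auto)
    then show "is_poly (\<lambda>t. gz_entry (X t) p w)"
      by (cases "a < l"; cases "b < l") (simp_all add: gz_entry_def pw)
  qed (use x0 X0 in \<open>auto simp: gz_indep_def\<close>)
  moreover have "finite {t. \<not> corner_indep M (X t)}" unfolding corner_indep_def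
  proof (rule indep_fam_cofinite)
    fix k and w :: "bool \<times> nat" assume "k \<in> {..M}" "w \<in> UNIV \<times> {..M}"
    then show "is_poly (\<lambda>t. corner_entry M (X t) k w)"
      using is_poly_pow_mat[OF Xc Xp, of M "snd w" k] is_poly_pow_mat[OF Xc Xp, of "snd w" M k]
      by (cases "fst w") (auto simp: corner_entry_def mem_Times_iff)
  qed (use x1 X1 in \<open>auto simp: corner_indep_def\<close>)
  ultimately have "finite ({t. \<not> gz_indep M (X t)} \<union> {t. \<not> corner_indep M (X t)})" by simp
  then obtain t where "t \<notin> {t. \<not> gz_indep M (X t)} \<union> {t. \<not> corner_indep M (X t)}"
    using ex_new_if_finite[OF infinite_UNIV_char_0] by blast
  then have "gz_indep (Suc M) (X t)" using gz_indep_Suc[OF Xc] by blast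
  then show ?thesis unfolding X_def by blast
qed

section \<open>Elements of a Borel subalgebra\<close>

text \<open>Elementary changes of basis. As a right factor, \<open>row_repl\<close> adds multiples
  of column \<open>k\<close> to the other columns and rescales column \<open>k\<close>, while
  \<open>col_repl\<close> replaces column \<open>k\<close> by a combination of all columns. They are
  upper triangular if \<open>v\<close> vanishes before \<open>k\<close> in the first case and after
  \<open>k\<close> in the second.\<close>

definition row_repl :: "nat \<Rightarrow> nat \<Rightarrow> (nat \<Rightarrow> complex) \<Rightarrow> complex mat" where
  "row_repl n k v = mat n n (\<lambda>(a,b). if a = k then v b else if a = b then 1 else 0)"

definition col_repl :: "nat \<Rightarrow> nat \<Rightarrow> (nat \<Rightarrow> complex) \<Rightarrow> complex mat" where
  "col_repl n k v = mat n n (\<lambda>(a,b). if b = k then v a else if a = b then 1 else 0)"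

lemma repl_carrier[simp]: "row_repl n k v \<in> carrier_mat n n" "col_repl n k v \<in> carrier_mat n n"
  by (auto simp: row_repl_def col_repl_def)

lemma mult_row_repl:
  assumes A: "A \<in> carrier_mat m n" and ab: "a < m" "b < n" "k < n"
  shows "(A * row_repl n k v) $$ (a,b) = A $$ (a,k) * v b + (if b = k then 0 else A $$ (a,b))"
proof -
  have "(A * row_repl n k v) $$ (a,b) = (\<Sum>c<n. A $$ (a,c) * row_repl n k v $$ (c,b))"
    by (rule index_mult_mat_sum[OF A repl_carrier(1) ab(1,2)])
  also have "\<dots> = (\<Sum>c<n. (if c = k then A $$ (a,k) * v b else 0) + (if c = b then (if b = k then 0 else A $$ (a,b)) else 0))"
    using ab by (intro sum.cong refl) (auto simp: row_repl_def)
  also have "\<dots> = A $$ (a,k) * v b + (if b = k then 0 else A $$ (a,b))"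
    using ab by (simp add: sum.distrib)
  finally show ?thesis .
qed

lemma col_repl_mult:
  assumes A: "A \<in> carrier_mat n m" and ab: "a < n" "b < m" "k < n"
  shows "(col_repl n k v * A) $$ (a,b) = v a * A $$ (k,b) + (if a = k then 0 else A $$ (a,b))"
proof -
  have "(col_repl n k v * A) $$ (a,b) = (\<Sum>c<n. col_repl n k v $$ (a,c) * A $$ (c,b))"
    by (rule index_mult_mat_sum[OF repl_carrier(2) A ab(1,2)])
  also have "\<dots> = (\<Sum>c<n. (if c = k then v a * A $$ (k,b) else 0) + (if c = a then (if a = k then 0 else A $$ (a,b)) else 0))"
    using ab by (intro sum.cong refl) (auto simp: col_repl_def)
  also have "\<dots> = v a * A $$ (k,b) + (if a = k then 0 else A $$ (a,b))"
    using ab by (simp add: sum.distrib)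
  finally show ?thesis .
qed

lemma mult_col_repl:
  assumes A: "A \<in> carrier_mat m n" and ab: "a < m" "b < n" "k < n"
  shows "(A * col_repl n k v) $$ (a,b) = (if b = k then (\<Sum>c<n. A $$ (a,c) * v c) else A $$ (a,b))"
proof -
  have "(A * col_repl n k v) $$ (a,b) = (\<Sum>c<n. A $$ (a,c) * col_repl n k v $$ (c,b))"
    by (rule index_mult_mat_sum[OF A repl_carrier(2) ab(1,2)])
  also have "\<dots> = (\<Sum>c<n. if b = k then A $$ (a,c) * v c else if c = b then A $$ (a,b) else 0)"
    using ab by (intro sum.cong refl) (auto simp: col_repl_def)
  finally show ?thesis using ab by simp
qed

lemma row_repl_mult_other:
  assumes A: "A \<in> carrier_mat n m" and ab: "a < n" "b < m" "a \<noteq> k"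
  shows "(row_repl n k v * A) $$ (a,b) = A $$ (a,b)"
proof -
  have "(row_repl n k v * A) $$ (a,b) = (\<Sum>c<n. row_repl n k v $$ (a,c) * A $$ (c,b))"
    by (rule index_mult_mat_sum[OF repl_carrier(1) A ab(1,2)])
  also have "\<dots> = (\<Sum>c<n. if c = a then A $$ (a,b) else 0)"
    using ab by (intro sum.cong refl) (auto simp: row_repl_def)
  finally show ?thesis using ab by simp
qed

text \<open>Coefficients of the inverse replacement, the same for rows and columns.\<close>

definition inv_coeffs :: "nat \<Rightarrow> (nat \<Rightarrow> complex) \<Rightarrow> nat \<Rightarrow> complex" where
  "inv_coeffs k v b = (if b = k then 1 / v k else - v b / v k)"

lemma row_repl_row_repl:
  assumes "k < n" and "v k \<noteq> 0"
  shows "row_repl n k v * row_repl n k (inv_coeffs k v) = 1\<^sub>m n" "row_repl n k (inv_coeffs k v) * row_repl n k v = 1\<^sub>m n"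
proof -
  show "row_repl n k v * row_repl n k (inv_coeffs k v) = 1\<^sub>m n"
    by (rule eq_matI, unfold index_one_mat(2,3))
      (subst mult_row_repl[OF repl_carrier(1)], auto simp: row_repl_def inv_coeffs_def assms)
  show "row_repl n k (inv_coeffs k v) * row_repl n k v = 1\<^sub>m n"
    by (rule eq_matI, unfold index_one_mat(2,3))
      (subst mult_row_repl[OF repl_carrier(1)], auto simp: row_repl_def inv_coeffs_def assms)
qed

lemma inv_pair_row_repl:
  assumes "k < n" "v k \<noteq> 0"
  shows "inv_pair n (row_repl n k v) (row_repl n k (inv_coeffs k v))"
  unfolding inv_pair_def using row_repl_row_repl[of k n v] assms by simp

lemma inv_pair_col_repl:
  assumes "k < n" "v k \<noteq> 0"
  shows "inv_pair n (col_repl n k v) (col_repl n k (inv_coeffs k v))"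
proof -
  have "col_repl n k v * col_repl n k (inv_coeffs k v) = 1\<^sub>m n"
    by (rule eq_matI, unfold index_one_mat(2,3))
      (subst col_repl_mult[OF repl_carrier(2)], auto simp: col_repl_def inv_coeffs_def assms)
  moreover have "col_repl n k (inv_coeffs k v) * col_repl n k v = 1\<^sub>m n"
    by (rule eq_matI, unfold index_one_mat(2,3))
      (subst col_repl_mult[OF repl_carrier(2)], auto simp: col_repl_def inv_coeffs_def assms)
  ultimately show ?thesis unfolding inv_pair_def by simp
qed

lemma row_repl_tri: "(\<And>b. b < k \<Longrightarrow> v b = 0) \<Longrightarrow> row_repl n k v \<in> tri_mats n 0"
  by (auto simp: tri_mats_def row_repl_def)

lemma col_repl_tri: "(\<And>a. a > k \<Longrightarrow> v a = 0) \<Longrightarrow> col_repl n k v \<in> tri_mats n 0"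
  by (auto simp: tri_mats_def col_repl_def)

lemma inv_coeffs_0: "v b = 0 \<Longrightarrow> b \<noteq> k \<Longrightarrow> inv_coeffs k v b = 0"
  by (simp add: inv_coeffs_def)

text \<open>An invertible upper triangular right factor of the basis matrix keeps the flag;
  algebraically, \<open>k * U * l\<close> is again upper triangular.\<close>

lemma conj_by_tri_change_basis:
  assumes gh: "inv_pair N g h" and kl: "k \<in> tri_mats N 0" "l \<in> tri_mats N 0"
  shows "conj_by (g * k) (l * h) (tri_mats N 0) \<subseteq> conj_by g h (tri_mats N 0)"
proof
  fix x assume "x \<in> conj_by (g * k) (l * h) (tri_mats N 0)"
  then obtain U where U: "U \<in> tri_mats N 0" "x = (g * k) * U * (l * h)" by (auto simp: conj_by_def)
  have c: "g \<in> carrier_mat N N" "h \<in> carrier_mat N N" "k \<in> carrier_mat N N" "l \<in> carrier_mat N N" "U \<in> carrier_mat N N"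
    using inv_pair_carrier[OF gh] kl U(1) by (auto simp: tri_mats_def)
  have "x = g * (k * U) * (l * h)" unfolding U(2) assoc_mult_mat[OF c(1,3,5)] ..
  also have "\<dots> = g * (k * U) * l * h"
    by (rule assoc_mult_mat[OF mult_carrier_mat[OF c(1) mult_carrier_mat[OF c(3,5)]] c(4) c(2), symmetric])
  also have "g * (k * U) * l = g * (k * U * l)"
    by (rule assoc_mult_mat[OF c(1) mult_carrier_mat[OF c(3,5)] c(4)])
  finally have "x = g * (k * U * l) * h" .
  moreover have "k * U * l \<in> tri_mats N 0"
    using tri_mats_mult[OF tri_mats_mult[OF kl(1) U(1)] kl(2)] by simp
  ultimately show "x \<in> conj_by g h (tri_mats N 0)" by (auto simp: conj_by_def)
qed

text \<open>\<open>k\<close> is the first column with nonzero last entry, the place where the flag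
  leaves the hyperplane of vectors with last coordinate zero. Adding multiples of column
  \<open>k\<close> to later columns clears the rest of the last row and respects the flag.\<close>

lemma last_row_normal_form:
  assumes gh: "inv_pair (Suc M) g h"
  obtains k G H where "k \<le> M" "inv_pair (Suc M) G H"
    "conj_by G H (tri_mats (Suc M) 0) \<subseteq> conj_by g h (tri_mats (Suc M) 0)"
    "\<And>j. j \<le> M \<Longrightarrow> G $$ (M,j) = (if j = k then 1 else 0)"
proof -
  note c = inv_pair_carrier[OF gh]
  have "\<exists>j. j \<le> M \<and> g $$ (M,j) \<noteq> 0"
  proof (rule ccontr)
    assume "\<not> ?thesis"
    then have "(g * h) $$ (M,M) = 0" using index_mult_mat_sum[OF c, of M M] by (simp add: lessThan_Suc_atMost)
    then show False using gh by (simp add: inv_pair_def)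
  qed
  then obtain k where k: "k \<le> M" "g $$ (M,k) \<noteq> 0" "\<And>j. j < k \<Longrightarrow> g $$ (M,j) = 0"
    using exists_least_iff[of "\<lambda>j. j \<le> M \<and> g $$ (M,j) \<noteq> 0"] by auto
  define v where "v j = g $$ (M,j)" for j
  \<comment> \<open>The last row of \<open>g\<close> is row \<open>k\<close> of \<open>?L\<close>,
    so multiplication by the inverse \<open>?K\<close> turns it into a unit row.\<close>
  let ?K = "row_repl (Suc M) k (inv_coeffs k v)" and ?L = "row_repl (Suc M) k v"
  have kl: "inv_pair (Suc M) ?K ?L"
    using inv_pair_sym[OF inv_pair_row_repl[of k "Suc M" v]] k by (simp add: v_def)
  have tri: "?K \<in> tri_mats (Suc M) 0" "?L \<in> tri_mats (Suc M) 0"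
    using k(3) by (auto intro!: row_repl_tri inv_coeffs_0 simp: v_def)
  have "(g * ?K) $$ (M,j) = (if j = k then 1 else 0)" if "j \<le> M" for j
    using mult_row_repl[OF c(1), of M j k "inv_coeffs k v"] that k by (simp add: inv_coeffs_def v_def)
  then show ?thesis using that[OF k(1) inv_pair_mult[OF gh kl] conj_by_tri_change_basis[OF gh tri]] by blast
qed

section \<open>Lifting from the corner\<close>

lemma gz_indep_lead_sub: "gz_indep M (lead_sub x M) \<longleftrightarrow> gz_indep M x"
proof -
  have "gz_entry (lead_sub x M) p w = gz_entry x p w" if "p \<in> GZ_index M" for p w
  proof -
    have "lead_sub (lead_sub x M) (fst p) = lead_sub x (fst p)"
      using that by (intro eq_matI) (auto simp: lead_sub_def GZ_index_def)
    then show ?thesis by (simp add: gz_entry_def)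
  qed
  then show ?thesis unfolding gz_indep_def indep_fam_def by (simp cong: sum.cong)
qed

lemma conj_by_mult_right:
  assumes gh: "inv_pair N g h" and U: "U \<in> carrier_mat N N"
  shows "g * U * h * g = g * U"
proof -
  note c = inv_pair_carrier[OF gh]
  have "g * U * h * g = g * U * (h * g)" by (rule assoc_mult_mat[OF mult_carrier_mat[OF c(1) U] c(2,1)])
  then show ?thesis using gh c U by (simp add: inv_pair_def)
qed

lemma mult_zero_vec:
  fixes A :: "complex mat"
  shows "A \<in> carrier_mat m n \<Longrightarrow> A *\<^sub>v 0\<^sub>v n = 0\<^sub>v m"
  by (intro eq_vecI) (simp_all add: scalar_prod_def)

lemma inv_pair_mult_vec_eq_0:
  assumes gh: "inv_pair N g h" and v: "v \<in> carrier_vec N" and 0: "g *\<^sub>v v = 0\<^sub>v N"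
  shows "v = 0\<^sub>v N"
proof -
  note c = inv_pair_carrier[OF gh]
  have "v = (h * g) *\<^sub>v v" using gh v by (simp only: inv_pair_def one_mult_mat_vec)
  also have "\<dots> = h *\<^sub>v 0\<^sub>v N" unfolding assoc_mult_mat_vec[OF c(2,1) v] 0 ..
  also have "\<dots> = 0\<^sub>v N" by (rule mult_zero_vec[OF c(2)])
  finally show ?thesis .
qed

text \<open>The witness inserts a zero row and column at position \<open>k\<close> into the given triangular matrix; deleting the last row and column \<open>k\<close> of \<open>G\<close> gives the basis \<open>g'\<close>.\<close>

lemma lead_sub_lifting:
  assumes gh: "inv_pair (Suc M) G H" and k: "k \<le> M"
    and last: "\<And>j. j \<le> M \<Longrightarrow> G $$ (M,j) = (if j = k then 1 else 0)"
  obtains g' h' where "inv_pair M g' h'"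
    "\<And>y. y \<in> conj_by g' h' (tri_mats M 0) \<Longrightarrow> \<exists>x\<in>conj_by G H (tri_mats (Suc M) 0). lead_sub x M = y"
proof -
  note c = inv_pair_carrier[OF gh]
  define g' where "g' = mat M M (\<lambda>(a,b). G $$ (a, insert_index k b))"
  have g': "g' \<in> carrier_mat M M" by (simp add: g'_def)
  have img: "insert_index k ` {..<M} = {..<Suc M} - {k}"
    using insert_index_image[of k M] k by (simp add: atLeast0LessThan)
  have ins_le: "insert_index k b \<le> M" if "b < M" for b using that by (auto simp: insert_index_def)
  have reindex: "(\<Sum>e<Suc M. f e) = f k + (\<Sum>b<M. f (insert_index k b))" for f :: "nat \<Rightarrow> complex"
  proof -
    have "(\<Sum>e<Suc M. f e) = f k + (\<Sum>e\<in>{..<Suc M} - {k}. f e)" using k by (intro sum.remove) auto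
    then show ?thesis unfolding img[symmetric] by (simp add: sum.reindex[OF insert_index_inj_on] o_def)
  qed
  have "inj_cols g'"
  proof (rule inj_colsI[OF g'])
    fix v assume v: "v \<in> carrier_vec M" and 0: "g' *\<^sub>v v = 0\<^sub>v M"
    \<comment> \<open>\<open>v\<close> is extended by zero at position \<open>k\<close>. The last
      entry of \<open>G *\<^sub>v w\<close> vanishes because the last row of \<open>G\<close> is
      zero away from \<open>k\<close>; the others are those of
      \<open>g' *\<^sub>v v\<close>.\<close>
    define w where "w = vec (Suc M) (\<lambda>a. if a = k then 0 else v $ (delete_index k a))"
    have w: "w \<in> carrier_vec (Suc M)" by (simp add: w_def)
    have wi: "w $ (insert_index k b) = v $ b" if "b < M" for b using ins_le[OF that] by (simp add: w_def less_Suc_eq_le)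
    have Gw: "(G *\<^sub>v w) $ a = (\<Sum>b<M. G $$ (a, insert_index k b) * v $ b)" if a: "a < Suc M" for a
    proof -
      have "(G *\<^sub>v w) $ a = (\<Sum>e<Suc M. G $$ (a,e) * w $ e)"
        using a c w by (simp add: scalar_prod_def atLeast0LessThan del: sum.lessThan_Suc)
      also have "\<dots> = (\<Sum>b<M. G $$ (a, insert_index k b) * v $ b)"
        unfolding reindex using k by (simp add: wi) (simp add: w_def)
      finally show ?thesis .
    qed
    have "G *\<^sub>v w = 0\<^sub>v (Suc M)"
    proof (rule eq_vecI)
      fix a assume "a < dim_vec (0\<^sub>v (Suc M) :: complex vec)"
      then have a: "a < Suc M" by simp
      show "(G *\<^sub>v w) $ a = 0\<^sub>v (Suc M) $ a"
      proof (cases "a = M")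
        case True
        then show ?thesis unfolding Gw[OF a] using last ins_le by simp
      next
        case False
        then have aM: "a < M" using a by simp
        have "(g' *\<^sub>v v) $ a = (\<Sum>b<M. G $$ (a, insert_index k b) * v $ b)"
          using aM v by (simp add: g'_def scalar_prod_def atLeast0LessThan)
        then show ?thesis unfolding Gw[OF a] using 0 aM by simp
      qed
    qed (use c in simp)
    then have "w = 0\<^sub>v (Suc M)" by (rule inv_pair_mult_vec_eq_0[OF gh w])
    then have w0: "w $ a = 0" if "a < Suc M" for a by (rule ssubst) (rule index_zero_vec(1)[OF that])
    have "v $ b = 0" if b: "b < M" for b
      using w0[of "insert_index k b"] ins_le[OF b] unfolding wi[OF b] less_Suc_eq_le by blast
    then show "v = 0\<^sub>v M" using v by (intro eq_vecI) auto
  qed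
  then obtain h' where g'h': "inv_pair M g' h'" using inv_pair_of_inj_cols[OF g'] by blast
  note c' = inv_pair_carrier[OF g'h']
  have "\<exists>x\<in>conj_by G H (tri_mats (Suc M) 0). lead_sub x M = y" if y: "y \<in> conj_by g' h' (tri_mats M 0)" for y
  proof -
    obtain V where V: "V \<in> tri_mats M 0" "y = g' * V * h'" using y by (auto simp: conj_by_def)
    have Vc: "V \<in> carrier_mat M M" using V by (auto simp: tri_mats_def)
    \<comment> \<open>The resulting matrix kills basis vector \<open>k\<close> and preserves the
      span of the others, which is the hyperplane of vectors with last coordinate zero.\<close>
    define U where "U = mat (Suc M) (Suc M) (\<lambda>(a,b). if a = k \<or> b = k then 0 else V $$ (delete_index k a, delete_index k b))"
    have Uc: "U \<in> carrier_mat (Suc M) (Suc M)" by (simp add: U_def)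
    have "U \<in> tri_mats (Suc M) 0" unfolding tri_mats_def
    proof (intro CollectI conjI allI impI Uc)
      fix i j assume ij: "i < Suc M" "j < Suc M" "j < i + 0"
      show "U $$ (i,j) = 0"
      proof (cases "i = k \<or> j = k")
        case False
        then have "delete_index k i < M" "delete_index k j < M" "delete_index k j < delete_index k i"
          using ij k by (auto simp: delete_index_def)
        then show ?thesis using False V(1) ij by (simp add: U_def tri_mats_def)
      qed (use ij in \<open>auto simp: U_def\<close>)
    qed
    moreover have "lead_sub (G * U * H) M = y"
    proof -
      define x where "x = G * U * H"
      have xc: "x \<in> carrier_mat (Suc M) (Suc M)" using c Uc by (simp add: x_def)
      have xG: "x * G = G * U" unfolding x_def by (rule conj_by_mult_right[OF gh Uc])
      \<comment> \<open>This is \<open>x * G = G * U\<close> read in rows with index less than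
        \<open>M\<close> and columns other than \<open>k\<close>. The terms at \<open>e = M\<close>
        vanish since the last row of \<open>G\<close> is zero in these columns, those at
        \<open>e = k\<close> since row \<open>k\<close> of \<open>U\<close> is zero.\<close>
      have "lead_sub x M * g' = g' * V"
      proof (rule eq_matI)
        fix a b assume "a < dim_row (g' * V)" "b < dim_col (g' * V)"
        then have ab: "a < M" "b < M" using g' Vc by auto
        then have ab': "a < Suc M" "insert_index k b < Suc M" using ins_le[OF ab(2)] by auto
        have "(lead_sub x M * g') $$ (a,b) = (\<Sum>e<M. x $$ (a,e) * G $$ (e, insert_index k b))"
          unfolding index_mult_mat_sum[OF lead_sub_carrier g' ab] using ab by (simp add: lead_sub_def g'_def)
        also have "\<dots> = (\<Sum>e<Suc M. x $$ (a,e) * G $$ (e, insert_index k b))"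
          using last[OF ins_le[OF ab(2)]] by simp
        also have "\<dots> = (G * U) $$ (a, insert_index k b)"
          unfolding xG[symmetric] index_mult_mat_sum[OF xc c(1) ab'] ..
        also have "\<dots> = (\<Sum>e<Suc M. G $$ (a,e) * U $$ (e, insert_index k b))"
          by (rule index_mult_mat_sum[OF c(1) Uc ab'])
        also have "\<dots> = (\<Sum>e<M. g' $$ (a,e) * V $$ (e,b))"
          unfolding reindex using ab ab' k ins_le by (simp add: U_def g'_def less_Suc_eq_le)
        also have "\<dots> = (g' * V) $$ (a,b)" by (rule index_mult_mat_sum[OF g' Vc ab, symmetric])
        finally show "(lead_sub x M * g') $$ (a,b) = (g' * V) $$ (a,b)" .
      qed (use g' Vc in \<open>auto simp: lead_sub_def\<close>)
      then have "y = lead_sub x M * g' * h'" unfolding V(2) by simp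
      also have "\<dots> = lead_sub x M * (g' * h')" by (rule assoc_mult_mat[OF lead_sub_carrier c'])
      also have "\<dots> = lead_sub x M" using g'h' right_mult_one_mat[OF lead_sub_carrier] by (simp add: inv_pair_def)
      finally show ?thesis by (simp add: x_def)
    qed
    ultimately show ?thesis unfolding conj_by_def by blast
  qed
  then show ?thesis using that g'h' by blast
qed

section \<open>Diagonal matrices in an adapted basis\<close>

lemma mat_diag_pow: "mat_diag n f ^\<^sub>m k = mat_diag n (\<lambda>i. f i ^ k :: complex)"
  by (induction k) (simp_all add: carrier_matD[OF mat_diag_dim] power_Suc2 del: power_Suc)

lemma conj_diag_pow_index:
  assumes GH: "inv_pair n G H" and ab: "a < n" "b < n"
  shows "((G * mat_diag n f * H) ^\<^sub>m k) $$ (a,b) = (\<Sum>i<n. G $$ (a,i) * f i ^ k * H $$ (i,b))"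
proof -
  note c = inv_pair_carrier[OF GH]
  have "similar_mat_wit (G * mat_diag n f * H) (mat_diag n f) G H"
    using GH c by (intro similar_mat_witI[of _ _ n]) (auto simp: inv_pair_def)
  then have e: "(G * mat_diag n f * H) ^\<^sub>m k = G * mat_diag n (\<lambda>i. f i ^ k) * H"
    using similar_mat_wit_pow_id mat_diag_pow by metis
  have Gd: "G * mat_diag n (\<lambda>i. f i ^ k) \<in> carrier_mat n n" using c by simp
  show ?thesis unfolding e index_mult_mat_sum[OF Gd c(2) ab]
    using ab c by (intro sum.cong refl) (simp add: mat_diag_mult_right[OF c(1)])
qed

text \<open>A polynomial in \<open>?x\<close> is \<open>G\<close> times a diagonal matrix with
  entries \<open>p i\<close> times \<open>H\<close>. Multiplying its last column by \<open>H\<close>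
  and its last row by \<open>G\<close> isolates \<open>p i * H $$ (i,M)\<close> and
  \<open>G $$ (M,i) * p i\<close>. So \<open>p\<close> vanishes at \<open>0\<close>, ...,
  \<open>M\<close>, too many roots for degree at most \<open>M\<close>.\<close>

lemma corner_indep_conj_diag:
  assumes GH: "inv_pair (Suc M) G H" and nz: "\<And>i. i \<le> M \<Longrightarrow> G $$ (M,i) \<noteq> 0 \<or> H $$ (i,M) \<noteq> 0"
  shows "corner_indep M (G * mat_diag (Suc M) of_nat * H)"
  unfolding corner_indep_def indep_fam_def
proof (intro allI impI ballI)
  note c = inv_pair_carrier[OF GH]
  let ?x = "G * mat_diag (Suc M) of_nat * H"
  fix d :: "nat \<Rightarrow> complex" and k0
  assume d: "\<forall>w\<in>UNIV \<times> {..M}. (\<Sum>k\<le>M. d k * corner_entry M ?x k w) = 0" and k0: "k0 \<in> {..M}"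
  define p where "p i = (\<Sum>k\<le>M. d k * of_nat i ^ k)" for i :: nat
  have entry: "(\<Sum>k\<le>M. d k * (?x ^\<^sub>m k) $$ (a,b)) = (\<Sum>i<Suc M. G $$ (a,i) * p i * H $$ (i,b))" if "a < Suc M" "b < Suc M" for a b
    unfolding conj_diag_pow_index[OF GH that] p_def sum_distrib_left sum_distrib_right
    by (subst sum.swap) (simp add: mult_ac)
  have HG: "(\<Sum>a<Suc M. H $$ (i,a) * G $$ (a,j)) = (if i = j then 1 else 0)" if "i < Suc M" "j < Suc M" for i j
    using index_mult_mat_sum[OF c(2,1) that] GH that by (simp add: inv_pair_def)
  have colz: "p j * H $$ (j,M) = 0" if j: "j < Suc M" for j
  proof -
    have z: "(\<Sum>i<Suc M. G $$ (a,i) * p i * H $$ (i,M)) = 0" if a: "a < Suc M" for a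
      using bspec[OF d, of "(True,a)"] entry[OF a lessI] a by (simp add: corner_entry_def)
    have "0 = (\<Sum>a<Suc M. H $$ (j,a) * (\<Sum>i<Suc M. G $$ (a,i) * p i * H $$ (i,M)))"
      by (intro sum.neutral[symmetric] ballI) (simp add: z del: sum.lessThan_Suc)
    also have "\<dots> = (\<Sum>i<Suc M. (\<Sum>a<Suc M. H $$ (j,a) * G $$ (a,i)) * (p i * H $$ (i,M)))"
      unfolding sum_distrib_left sum_distrib_right by (subst sum.swap) (simp add: mult_ac)
    also have "\<dots> = (\<Sum>i<Suc M. if i = j then p j * H $$ (j,M) else 0)"
      by (intro sum.cong refl) (use HG j in auto)
    finally show ?thesis using j by (simp del: sum.lessThan_Suc)
  qed
  have rowz: "G $$ (M,j) * p j = 0" if j: "j < Suc M" for j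
  proof -
    have z: "(\<Sum>i<Suc M. G $$ (M,i) * p i * H $$ (i,a)) = 0" if a: "a < Suc M" for a
      using bspec[OF d, of "(False,a)"] entry[OF lessI a] a by (simp add: corner_entry_def)
    have "0 = (\<Sum>a<Suc M. (\<Sum>i<Suc M. G $$ (M,i) * p i * H $$ (i,a)) * G $$ (a,j))"
      by (intro sum.neutral[symmetric] ballI) (simp add: z del: sum.lessThan_Suc)
    also have "\<dots> = (\<Sum>i<Suc M. (\<Sum>a<Suc M. H $$ (i,a) * G $$ (a,j)) * (G $$ (M,i) * p i))"
      unfolding sum_distrib_left sum_distrib_right by (subst sum.swap) (simp add: mult_ac)
    also have "\<dots> = (\<Sum>i<Suc M. if i = j then G $$ (M,j) * p j else 0)"
      by (intro sum.cong refl) (use HG j in auto)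
    finally show ?thesis using j by (simp del: sum.lessThan_Suc)
  qed
  have pz: "p j = 0" if "j \<le> M" for j using colz[of j] rowz[of j] nz[OF that] that by auto
  show "d k0 = 0"
  proof (rule ccontr)
    assume "d k0 \<noteq> 0"
    then have *: "finite {z. (\<Sum>i\<le>M. d i * z ^ i) = 0} \<and> card {z. (\<Sum>i\<le>M. d i * z ^ i) = 0} \<le> M"
      using k0 by (intro polyfun_rootbound) auto
    have "of_nat ` {..M} \<subseteq> {z. (\<Sum>i\<le>M. d i * z ^ i) = 0}" using pz by (auto simp: p_def)
    then have "card (of_nat ` {..M} :: complex set) \<le> M" using * card_mono by (meson le_trans)
    moreover have "card (of_nat ` {..M} :: complex set) = Suc M" by (subst card_image) (auto simp: inj_on_def)
    ultimately show False by simp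
  qed
qed

text \<open>Every basis adapted to the flag has last row zero before \<open>k\<close>, so there the
  coordinates of the last unit vector must be made nonzero. Changing basis vector \<open>k\<close>
  by earlier ones achieves this; adding it to the later ones then fills the last row from
  \<open>k\<close> on.\<close>

lemma exists_corner_indep:
  assumes GH: "inv_pair (Suc M) G H" and k: "k \<le> M"
    and last: "\<And>j. j \<le> M \<Longrightarrow> G $$ (M,j) = (if j = k then 1 else 0)"
  shows "\<exists>x\<in>conj_by G H (tri_mats (Suc M) 0). corner_indep M x"
proof -
  let ?N = "Suc M"
  note c = inv_pair_carrier[OF GH]
  define e where "e i = H $$ (i,M)" for i
  have ek: "e k = 1"
  proof -
    have "1 = (G * H) $$ (M,M)" using GH by (simp add: inv_pair_def)
    also have "\<dots> = (\<Sum>j<Suc M. if j = k then e k else 0)"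
      unfolding index_mult_mat_sum[OF c lessI lessI] by (intro sum.cong refl) (auto simp: last e_def)
    finally show ?thesis using k by (simp del: sum.lessThan_Suc)
  qed
  \<comment> \<open>For \<open>i < k\<close> the last entry of row \<open>i\<close> of
    \<open>?C' * H\<close> is \<open>\<alpha> i * e k + e i\<close>, which equals 1 for this choice
    because \<open>e k = 1\<close>. The zeros after \<open>k\<close> keep the matrix
    triangular.\<close>
  define \<alpha> where "\<alpha> i = (if i = k then 1 else if i < k then 1 - e i else 0)" for i
  \<comment> \<open>\<open>\<beta>\<close> becomes the new last row: zero before \<open>k\<close>
    for triangularity, 1 from \<open>k\<close> on. The inverse \<open>?R'\<close> changes only row
    \<open>k\<close> of \<open>?C' * H\<close>, so the entries arranged before \<open>k\<close>
    survive.\<close>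
  define \<beta> where "\<beta> i = (if i < k then 0 else 1 :: complex)" for i
  let ?C = "col_repl ?N k (inv_coeffs k \<alpha>)" and ?C' = "col_repl ?N k \<alpha>"
  let ?R = "row_repl ?N k \<beta>" and ?R' = "row_repl ?N k (inv_coeffs k \<beta>)"
  have kN: "k < ?N" using k by simp
  have CC: "inv_pair ?N ?C ?C'" by (rule inv_pair_sym[OF inv_pair_col_repl[OF kN]]) (simp add: \<alpha>_def)
  have RR: "inv_pair ?N ?R ?R'" by (rule inv_pair_row_repl[OF kN]) (simp add: \<beta>_def)
  have tri: "?C \<in> tri_mats ?N 0" "?C' \<in> tri_mats ?N 0" "?R \<in> tri_mats ?N 0" "?R' \<in> tri_mats ?N 0"
    by (auto intro!: col_repl_tri row_repl_tri inv_coeffs_0 simp: \<alpha>_def \<beta>_def)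
  have GC: "inv_pair ?N (G * ?C) (?C' * H)" by (rule inv_pair_mult[OF GH CC])
  have GCR: "inv_pair ?N (G * ?C * ?R) (?R' * (?C' * H))" by (rule inv_pair_mult[OF GC RR])
  note cGC = inv_pair_carrier[OF GC]
  have rowGC: "(G * ?C) $$ (M,j) = (if j = k then 1 else 0)" if j: "j \<le> M" for j
  proof -
    have "(\<Sum>i<Suc M. G $$ (M,i) * inv_coeffs k \<alpha> i) = (\<Sum>i<Suc M. if i = k then 1 else 0)"
      by (intro sum.cong refl) (auto simp: last inv_coeffs_def \<alpha>_def)
    also have "\<dots> = 1" using k by (simp del: sum.lessThan_Suc)
    finally show ?thesis using mult_col_repl[OF c(1) lessI _ kN, of j "inv_coeffs k \<alpha>"] j last by (simp del: sum.lessThan_Suc)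
  qed
  have colCH: "(?C' * H) $$ (i,M) = 1" if i: "i < k" for i
    using col_repl_mult[OF c(2) _ lessI kN, of i \<alpha>] i k ek by (simp add: e_def \<alpha>_def)
  have "(G * ?C * ?R) $$ (M,i) \<noteq> 0 \<or> (?R' * (?C' * H)) $$ (i,M) \<noteq> 0" if i: "i \<le> M" for i
  proof (cases "i < k")
    case True
    then show ?thesis using row_repl_mult_other[OF cGC(2) _ lessI, of i k "inv_coeffs k \<beta>"] colCH[OF True] i by simp
  next
    case False
    then show ?thesis using mult_row_repl[OF cGC(1) lessI _ kN, of i \<beta>] rowGC i k by (simp add: \<beta>_def)
  qed
  then have "corner_indep M (G * ?C * ?R * mat_diag ?N of_nat * (?R' * (?C' * H)))"
    by (rule corner_indep_conj_diag[OF GCR])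
  moreover have "mat_diag ?N of_nat \<in> tri_mats ?N 0" by (auto simp: tri_mats_def mat_diag_def)
  then have "G * ?C * ?R * mat_diag ?N of_nat * (?R' * (?C' * H)) \<in> conj_by (G * ?C * ?R) (?R' * (?C' * H)) (tri_mats ?N 0)"
    unfolding conj_by_def by (rule imageI)
  then have "G * ?C * ?R * mat_diag ?N of_nat * (?R' * (?C' * H)) \<in> conj_by G H (tri_mats ?N 0)"
    using conj_by_tri_change_basis[OF GC tri(3,4)] conj_by_tri_change_basis[OF GH tri(1,2)] by blast
  ultimately show ?thesis by blast
qed

text \<open>\<open>g\<close> and \<open>h\<close> vary in the induction because the corner supplies
  a new basis \<open>g'\<close>. Both points \<open>x0\<close> and \<open>x1\<close> lie in the same
  conjugate, a linear subspace, which therefore contains the whole line through them.\<close>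

lemma exists_gz_indep:
  assumes "inv_pair N g h"
  shows "\<exists>x\<in>conj_by g h (tri_mats N 0). gz_indep N x"
  using assms
proof (induction N arbitrary: g h)
  case 0
  have "GZ_index 0 = {}" by (auto simp: GZ_index_def)
  then have "gz_indep 0 x" for x by (simp add: gz_indep_def indep_fam_def)
  moreover have "0\<^sub>m 0 0 \<in> tri_mats 0 0" by (simp add: tri_mats_def)
  ultimately show ?case unfolding conj_by_def by blast
next
  case (Suc M)
  obtain k G H where k: "k \<le> M" and GH: "inv_pair (Suc M) G H"
    and sub: "conj_by G H (tri_mats (Suc M) 0) \<subseteq> conj_by g h (tri_mats (Suc M) 0)"
    and last: "\<And>j. j \<le> M \<Longrightarrow> G $$ (M,j) = (if j = k then 1 else 0)"
    using last_row_normal_form[OF Suc.prems] by blast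
  let ?B = "conj_by G H (tri_mats (Suc M) 0)"
  obtain g' h' where g'h': "inv_pair M g' h'"
    and lift: "\<And>y. y \<in> conj_by g' h' (tri_mats M 0) \<Longrightarrow> \<exists>x\<in>?B. lead_sub x M = y"
    using lead_sub_lifting[OF GH k last] by blast
  obtain y where y: "y \<in> conj_by g' h' (tri_mats M 0)" "gz_indep M y" using Suc.IH[OF g'h'] by blast
  then obtain x0 where x0: "x0 \<in> ?B" "lead_sub x0 M = y" using lift by blast
  then have gz0: "gz_indep M x0" using y(2) gz_indep_lead_sub[of M x0] by simp
  obtain x1 where x1: "x1 \<in> ?B" "corner_indep M x1" using exists_corner_indep[OF GH k last] by blast
  have sp: "csubspace_gl (Suc M) ?B" by (rule csubspace_conj_by[OF GH csubspace_tri_mats])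
  have c: "x0 \<in> carrier_mat (Suc M) (Suc M)" "x1 \<in> carrier_mat (Suc M) (Suc M)"
    using sp x0(1) x1(1) unfolding csubspace_gl_def by blast+
  obtain t where t: "gz_indep (Suc M) (x0 + t \<cdot>\<^sub>m (x1 - x0))"
    using exists_gz_indep_on_line[OF c(1) gz0 c(2) x1(2)] by blast
  have "x1 - x0 = x1 + (-1) \<cdot>\<^sub>m x0" using c by (intro eq_matI) auto
  then have "x0 + t \<cdot>\<^sub>m (x1 - x0) \<in> ?B" using sp x0(1) x1(1) unfolding csubspace_gl_def by simp
  then show ?case using t sub by blast
qed

theorem theorem5p3:
  fixes n :: nat and b :: "complex mat set"
  assumes "borel_subalgebra (n + 1) b"
  shows "\<exists>x\<in>b. strongly_regular (n + 1) x"
proof -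
  obtain g h where gh: "inv_pair (n + 1) g h" and b: "b = conj_by g h (tri_mats (n + 1) 0)"
    using borel_subalgebra_conj_tri[OF assms] by blast
  obtain x where x: "x \<in> b" "gz_indep (n + 1) x" using exists_gz_indep[OF gh] b by blast
  have "x \<in> carrier_mat (n + 1) (n + 1)"
    using x(1) csubspace_conj_by[OF gh csubspace_tri_mats[of _ 0]] unfolding b csubspace_gl_def by blast
  then show ?thesis using gz_indep_imp_strongly_regular x by blast
qed

end
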